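(* Let $K$ be a polyhedral (proper) cone of $\mathbb{R}^n$ and let $A\in\pi(K)$. Let $\lambda$ be a distinguished eigenvalue of $A$ for $K$. Denote by $m_\lambda$ the maximal order of distinguished generalized eigenvectors of $A$ corresponding to $\lambda$. Then there is a chain of $m_\lambda$ distinct semi-distinguished $A$-invariant faces of $K$ associated with $\lambda$, but there is no such chain with more than $m_\lambda$ members.
   Context: A proper cone of $\mathbb{R}^n$ is a closed convex cone that is pointed ($K\cap(-K)=\{0\}$) and has nonempty interior; it is polyhedral if it has finitely many extreme rays. $\pi(K)$ is the set of real $n\times n$ matrices $A$ with $AK\subseteq K$. A face of $K$ is a convex subcone $F\subseteq K$ such that $x,y\in K$, $x+y\in F$ imply $x,y\in F$; it is $A$-invariant if $AF\subseteq F$. The join $F\vee G$ of two faces is the smallest face of $K$ including $F\cup G$. An $A$-invariant face $F$ is $A$-invariant join-irreducible if it is not the join of two $A$-invariant faces of $K$ properly included in $F$. A generalized eigenvector of $A$ corresponding to $\lambda$ is a nonzero $x$ with $(\lambda I-A)^kx=0$ for some positive integer $k$; the least such $k$ is its order. A distinguished (generalized) eigenvector of $A$ for $K$ is a (generalized) eigenvector lying in $K$; a distinguished eigenvalue of $A$ for $K$ is an eigenvalue having an eigenvector in $K$. A semi-distinguished $A$-invariant face associated with $\lambda$ is an $A$-invariant join-irreducible face of $K$ which contains in its relative interior a generalized eigenvector of $A$ corresponding to $\lambda$. A chain is a family of faces pairwise comparable under inclusion. *)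

theory Defs
  imports "HOL-Analysis.Analysis"
begin

section \<open>Proper cones and their faces\<close>

definition proper_cone :: "(real ^ 'n) set \<Rightarrow> bool" where
  "proper_cone K \<longleftrightarrow>
     closed K \<and> convex_cone K \<and> K \<inter> uminus ` K = {0} \<and> interior K \<noteq> {}"

text \<open>
  This is the notion of face for cones: unlike \<^const>\<open>face_of\<close>, it excludes the empty set,
  since \<^const>\<open>convex_cone\<close> includes nonemptiness (so every face contains 0).
\<close>

definition cone_face :: "(real ^ 'n) set \<Rightarrow> (real ^ 'n) set \<Rightarrow> bool" where
  "cone_face K F \<longleftrightarrow>
     convex_cone F \<and> F \<subseteq> K \<and> (\<forall>x\<in>K. \<forall>y\<in>K. x + y \<in> F \<longrightarrow> x \<in> F \<and> y \<in> F)"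

definition extreme_ray :: "(real ^ 'n) set \<Rightarrow> (real ^ 'n) set \<Rightarrow> bool" where
  "extreme_ray K R \<longleftrightarrow> cone_face K R \<and> (\<exists>x. x \<noteq> 0 \<and> R = conic hull {x})"

definition polyhedral_cone :: "(real ^ 'n) set \<Rightarrow> bool" where
  "polyhedral_cone K \<longleftrightarrow> proper_cone K \<and> finite {R. extreme_ray K R}"

definition face_join ::
    "(real ^ 'n) set \<Rightarrow> (real ^ 'n) set \<Rightarrow> (real ^ 'n) set \<Rightarrow> (real ^ 'n) set" where
  "face_join K F G = cone_face K hull (F \<union> G)"

text \<open>
  The hull is an intersection of faces; the next lemma confirms that it is indeed the
  smallest face including both arguments.
\<close>

lemma face_join_smallest:
  assumes "convex_cone K" and "cone_face K F" and "cone_face K G"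
  shows "cone_face K (face_join K F G)"
    and "F \<union> G \<subseteq> face_join K F G"
    and "\<And>H. cone_face K H \<Longrightarrow> F \<union> G \<subseteq> H \<Longrightarrow> face_join K F G \<subseteq> H"
proof -
  have KK: "cone_face K K"
    using assms(1) by (simp add: cone_face_def)
  have FG: "F \<union> G \<subseteq> K"
    using assms(2,3) by (auto simp: cone_face_def)
  define T where "T = {H. cone_face K H \<and> F \<union> G \<subseteq> H}"
  have join: "face_join K F G = \<Inter>T"
    by (simp add: face_join_def hull_def T_def)
  have face: "cone_face K H" if "H \<in> T" for H
    using that by (simp add: T_def)
  have "0 \<in> \<Inter>T"
    using face by (auto simp: cone_face_def intro: convex_cone_contains_0)
  moreover have "x + y \<in> \<Inter>T" if "x \<in> \<Inter>T" "y \<in> \<Inter>T" for x y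
    using that face by (meson InterI InterD cone_face_def convex_cone_add)
  moreover have "c *\<^sub>R x \<in> \<Inter>T" if "x \<in> \<Inter>T" "0 \<le> c" for x c
    using that face by (meson InterI InterD cone_face_def convex_cone_scaleR)
  ultimately have "convex_cone (\<Inter>T)"
    unfolding convex_cone_iff by blast
  moreover have "\<Inter>T \<subseteq> K"
    using KK FG by (auto simp: T_def)
  moreover have "x \<in> \<Inter>T \<and> y \<in> \<Inter>T" if "x \<in> K" "y \<in> K" "x + y \<in> \<Inter>T" for x y
    using that face by (meson InterI InterD cone_face_def)
  ultimately show "cone_face K (face_join K F G)"
    unfolding join cone_face_def by blast
  show "F \<union> G \<subseteq> face_join K F G"
    unfolding face_join_def by (rule hull_subset)
  show "face_join K F G \<subseteq> H" if "cone_face K H" "F \<union> G \<subseteq> H" for H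
    unfolding face_join_def using that by (simp add: hull_minimal)
qed

section \<open>Matrices preserving a cone\<close>

definition cone_preserving :: "(real ^ 'n) set \<Rightarrow> (real ^ 'n ^ 'n) set" where
  "cone_preserving K = {A. (*v) A ` K \<subseteq> K}"

definition invariant_face :: "real ^ 'n ^ 'n \<Rightarrow> (real ^ 'n) set \<Rightarrow> (real ^ 'n) set \<Rightarrow> bool" where
  "invariant_face A K F \<longleftrightarrow> cone_face K F \<and> (*v) A ` F \<subseteq> F"

definition invariant_join_irreducible ::
    "real ^ 'n ^ 'n \<Rightarrow> (real ^ 'n) set \<Rightarrow> (real ^ 'n) set \<Rightarrow> bool" where
  "invariant_join_irreducible A K F \<longleftrightarrow>
     invariant_face A K F \<and>
     \<not> (\<exists>G H. invariant_face A K G \<and> invariant_face A K H \<and>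
              G \<subset> F \<and> H \<subset> F \<and> F = face_join K G H)"

section \<open>Distinguished generalized eigenvectors\<close>

definition eigenvector :: "real ^ 'n ^ 'n \<Rightarrow> real \<Rightarrow> real ^ 'n \<Rightarrow> bool" where
  "eigenvector A lam x \<longleftrightarrow> x \<noteq> 0 \<and> A *v x = lam *\<^sub>R x"

definition distinguished_eigenvalue :: "real ^ 'n ^ 'n \<Rightarrow> (real ^ 'n) set \<Rightarrow> real \<Rightarrow> bool" where
  "distinguished_eigenvalue A K lam \<longleftrightarrow> (\<exists>x\<in>K. eigenvector A lam x)"

text \<open>
  Powers of \<open>lam I - A\<close> are iterates of the map \<open>x \<mapsto> (lam I - A) x\<close>: the library's power operation
  on the type \<open>real ^ 'n ^ 'n\<close> is entrywise and not the matrix power.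
\<close>

definition annihilated :: "real ^ 'n ^ 'n \<Rightarrow> real \<Rightarrow> nat \<Rightarrow> real ^ 'n \<Rightarrow> bool" where
  "annihilated A lam k x \<longleftrightarrow> ((*v) (mat lam - A) ^^ k) x = 0"

definition generalized_eigenvector :: "real ^ 'n ^ 'n \<Rightarrow> real \<Rightarrow> real ^ 'n \<Rightarrow> bool" where
  "generalized_eigenvector A lam x \<longleftrightarrow> x \<noteq> 0 \<and> (\<exists>k>0. annihilated A lam k x)"

definition eigenvector_order :: "real ^ 'n ^ 'n \<Rightarrow> real \<Rightarrow> real ^ 'n \<Rightarrow> nat" where
  "eigenvector_order A lam x = (LEAST k. k > 0 \<and> annihilated A lam k x)"

text \<open>
  The maximum is over a finite set, as orders are at most \<open>n\<close>; the set is nonempty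
  when \<open>lam\<close> is a distinguished eigenvalue.
\<close>

definition max_distinguished_order :: "real ^ 'n ^ 'n \<Rightarrow> (real ^ 'n) set \<Rightarrow> real \<Rightarrow> nat" where
  "max_distinguished_order A K lam =
     Max (eigenvector_order A lam ` {x \<in> K. generalized_eigenvector A lam x})"

definition semi_distinguished_face ::
    "real ^ 'n ^ 'n \<Rightarrow> (real ^ 'n) set \<Rightarrow> real \<Rightarrow> (real ^ 'n) set \<Rightarrow> bool" where
  "semi_distinguished_face A K lam F \<longleftrightarrow>
     invariant_join_irreducible A K F \<and>
     (\<exists>x \<in> rel_interior F. generalized_eigenvector A lam x)"

end

theory Submission
  imports Defs
begin

text \<open>
  Put \<open>D = A - lam I\<close>. A polyhedral cone is cut out by finitely many linear functionals, so
  positivity of \<open>((lam + s) I - A)\<^sup>-\<^sup>1\<close> for small \<open>s > 0\<close> can be read off from the leading coefficient of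
  its pole at \<open>s = 0\<close>, one functional at a time. It follows that the principal part at a small \<open>s\<close> of
  the resolvent applied to a vector of an invariant face is a generalized eigenvector \<open>q\<close> in that face
  with \<open>D\<^sup>i q\<close> nonnegative for all \<open>i\<close>, and that the order of generalized eigenvectors is monotone
  for the order of the cone.

  In a join-irreducible invariant face with a generalized eigenvector \<open>x\<close> in its relative interior,
  generalized eigenvectors in proper invariant subfaces have order smaller than that of \<open>x\<close>; this
  bounds the length of chains. Conversely, an invariant face that is minimal among those containing a
  generalized eigenvector \<open>q\<close> of order at least \<open>p\<close> is join-irreducible, since \<open>q \<le> g + h\<close> forces a pole
  of order at least \<open>p\<close> in the resolvent at \<open>g\<close> or at \<open>h\<close>; passing from \<open>q\<close> to \<open>D q\<close> yields a chain.
\<close>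

section \<open>Polyhedral cones as intersections of half-spaces\<close>

text \<open>By pointedness the nonzero elements of \<open>K\<close> form a convex set, so the convex
  hull of the compact set of unit vectors in \<open>K\<close> misses 0 and can be strictly separated
  from it; scaling gives the bound. The functional later yields a compact base and turns domination
  in the cone order into norm estimates.\<close>

lemma proper_cone_positive_functional:
  assumes "proper_cone K"
  obtains a b where "0 < b" "\<And>x. x \<in> K \<Longrightarrow> b * norm x \<le> a \<bullet> x"
proof -
  have K: "closed K" "convex_cone K" "K \<inter> uminus ` K = {0}"
    using assms by (auto simp: proper_cone_def)
  have conv: "convex (K - {0})"
  proof (rule convexI)
    fix x y and u v :: real
    assume xy: "x \<in> K - {0}" "y \<in> K - {0}" and uv: "0 \<le> u" "0 \<le> v" "u + v = 1"
    have u: "u *\<^sub>R x \<in> K" and v: "v *\<^sub>R y \<in> K"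
      using xy uv K(2) by (auto intro: convex_cone_scaleR)
    have False if "u *\<^sub>R x + v *\<^sub>R y = 0"
    proof -
      have eq: "u *\<^sub>R x = - (v *\<^sub>R y)"
        using that by (simp add: eq_neg_iff_add_eq_0)
      then have "u *\<^sub>R x \<in> K \<inter> uminus ` K"
        using u v by auto
      then have "u *\<^sub>R x = 0"
        using K(3) by auto
      moreover from this have "v *\<^sub>R y = 0"
        using eq by simp
      ultimately show False
        using xy uv by simp
    qed
    then show "u *\<^sub>R x + v *\<^sub>R y \<in> K - {0}"
      using u v K(2) convex_cone_add by blast
  qed
  let ?S = "convex hull (K \<inter> sphere 0 1)"
  have "compact ?S"
    using K(1) by (intro compact_convex_hull closed_Int_compact) auto
  moreover have "?S \<subseteq> K - {0}"
    by (rule hull_minimal) (use conv in auto)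
  ultimately have "\<exists>a b. a \<noteq> 0 \<and> 0 < b \<and> (\<forall>x\<in>?S. b < a \<bullet> x)"
    by (intro separating_hyperplane_closed_0 compact_imp_closed) auto
  then obtain a b where b: "0 < b" and ab: "\<And>x. x \<in> ?S \<Longrightarrow> b < a \<bullet> x"
    by blast
  have "b * norm x \<le> a \<bullet> x" if "x \<in> K" for x
  proof (cases "x = 0")
    case False
    have "(1 / norm x) *\<^sub>R x \<in> K \<inter> sphere 0 1"
      using that False convex_cone_scaleR[OF K(2)] by simp
    then have "b < a \<bullet> ((1 / norm x) *\<^sub>R x)"
      by (intro ab hull_inc)
    then show ?thesis
      using False by (simp add: field_simps)
  qed simp
  with b that show ?thesis by blast
qed

text \<open>The extreme rays are cut out of the cone by the extreme points of a compact slice.\<close>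

lemma polyhedral_cone_halfspaces:
  fixes K :: "(real ^ 'n) set"
  assumes "polyhedral_cone K"
  obtains Fs where "finite Fs" "K = {x. \<forall>f\<in>Fs. 0 \<le> f \<bullet> x}"
proof -
  have proper: "proper_cone K" and fin: "finite {R. extreme_ray K R}"
    using assms by (auto simp: polyhedral_cone_def)
  have K: "closed K" "convex_cone K" "K \<inter> uminus ` K = {0}"
    using proper by (auto simp: proper_cone_def)
  obtain a b where b: "0 < b" and ab: "\<And>x. x \<in> K \<Longrightarrow> b * norm x \<le> a \<bullet> x"
    using proper_cone_positive_functional[OF proper] by blast
  \<comment> \<open>\<open>B\<close> is a compact base: every nonzero element of \<open>K\<close> is
    a positive multiple of one of its points.\<close>
  define B where "B = K \<inter> {x. a \<bullet> x = 1}"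
  have pos: "0 < a \<bullet> x" if "x \<in> K" "x \<noteq> 0" for x
    using ab[OF that(1)] b that(2) by (smt (verit) mult_pos_pos zero_less_norm_iff)
  have "convex B"
    unfolding B_def using K(2) by (intro convex_Int convex_hyperplane) (auto simp: convex_cone_def)
  moreover have "compact B"
  proof -
    have "norm x \<le> 1 / b" if "x \<in> B" for x
      using ab[of x] b that by (auto simp: B_def field_simps)
    then have "bounded B"
      by (auto simp: bounded_iff)
    moreover have "closed B"
      unfolding B_def using K(1) by (intro closed_Int closed_hyperplane)
    ultimately show ?thesis
      by (simp add: compact_eq_bounded_closed)
  qed
  ultimately have BE: "B = convex hull {x. x extreme_point_of B}"
    by (simp add: Krein_Milman_Minkowski)
  have scaled: "(1 / (a \<bullet> x)) *\<^sub>R x \<in> B" if "x \<in> K" "x \<noteq> 0" for x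
    using pos[OF that] that K(2) by (auto simp: B_def intro!: convex_cone_scaleR)
  have ray: "extreme_ray K (conic hull {e})" if e: "e extreme_point_of B" for e
  proof -
    have eB: "e \<in> B"
      using e by (simp add: extreme_point_of_def)
    then have eK: "e \<in> K" and ae: "a \<bullet> e = 1"
      by (auto simp: B_def)
    have hull: "conic hull {e} = {c *\<^sub>R e |c. 0 \<le> c}"
      by (auto simp: conic_hull_explicit)
    \<comment> \<open>After normalization to \<open>B\<close>, such a splitting writes
      \<open>e\<close> as a convex combination with weights \<open>p / c\<close> and
      \<open>q / c\<close>; extremality makes the two normalized points coincide.\<close>
    have splits: "x \<in> conic hull {e}"
      if xy: "x \<in> K" "y \<in> K" and c: "0 \<le> c" "x + y = c *\<^sub>R e" for x y c
    proof (cases "x = 0 \<or> y = 0")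
      case True
      then show ?thesis
        using c unfolding hull by (auto intro: exI[of _ 0])
    next
      case False
      define p q where "p = a \<bullet> x" and "q = a \<bullet> y"
      have p: "0 < p" and q: "0 < q"
        using False pos xy by (auto simp: p_def q_def)
      have "p + q = a \<bullet> (x + y)"
        by (simp add: p_def q_def inner_add_right)
      then have pq: "p + q = c"
        using c ae by simp
      have "e = (1 / c) *\<^sub>R (x + y)"
        using c pq p q by simp
      also have "\<dots> = (1 - q / c) *\<^sub>R ((1 / p) *\<^sub>R x) + (q / c) *\<^sub>R ((1 / q) *\<^sub>R y)"
      proof -
        have "(1 - q / c) * (1 / p) = 1 / c"
          using pq p q by (auto simp: field_simps)
        then show ?thesis
          using p q by (simp add: scaleR_add_right)
      qed
      finally have e_eq: "e = (1 - q / c) *\<^sub>R ((1 / p) *\<^sub>R x) + (q / c) *\<^sub>R ((1 / q) *\<^sub>R y)" .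
      have xB: "(1 / p) *\<^sub>R x \<in> B" and yB: "(1 / q) *\<^sub>R y \<in> B"
        using scaled False xy by (auto simp: p_def q_def)
      have "(1 / p) *\<^sub>R x = (1 / q) *\<^sub>R y"
      proof (rule ccontr)
        assume "(1 / p) *\<^sub>R x \<noteq> (1 / q) *\<^sub>R y"
        moreover have "0 < q / c" "q / c < 1"
          using pq p q by auto
        ultimately have "e \<in> open_segment ((1 / p) *\<^sub>R x) ((1 / q) *\<^sub>R y)"
          unfolding in_segment using e_eq by blast
        then show False
          using e xB yB by (auto simp: extreme_point_of_def)
      qed
      then have "e = (1 / p) *\<^sub>R x"
        using e_eq by (metis scaleR_collapse)
      then have "x = p *\<^sub>R e"
        using p by simp
      then show ?thesis
        using p unfolding hull by auto
    qed
    have "cone_face K (conic hull {e})"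
      unfolding cone_face_def
    proof (intro conjI ballI impI)
      show "convex_cone (conic hull {e})"
        by (simp add: convex_cone_def convex_conic_hull conic_conic_hull conic_hull_eq_empty)
      show "conic hull {e} \<subseteq> K"
        unfolding hull using eK K(2) by (auto intro: convex_cone_scaleR)
      fix x y assume xy: "x \<in> K" "y \<in> K" "x + y \<in> conic hull {e}"
      then obtain c where "0 \<le> c" "x + y = c *\<^sub>R e"
        unfolding hull by blast
      then show "x \<in> conic hull {e}" "y \<in> conic hull {e}"
        using xy splits[of x y c] splits[of y x c] by (simp_all add: add.commute)
    qed
    moreover have "e \<noteq> 0"
      using ae by auto
    ultimately show ?thesis
      by (auto simp: extreme_ray_def)
  qed
  \<comment> \<open>Distinct extreme points of the base span distinct rays, so finitely many extreme
    rays means finitely many extreme points, and these generate \<open>K\<close>.\<close>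
  have "inj_on (\<lambda>e. conic hull {e}) {x. x extreme_point_of B}"
  proof (rule inj_onI, unfold mem_Collect_eq)
    fix e e' assume e: "e extreme_point_of B" "e' extreme_point_of B"
      and eq: "conic hull {e} = conic hull {e'}"
    have "e \<in> conic hull {e'}"
      unfolding eq[symmetric] by (rule hull_inc) simp
    then obtain c where "e = c *\<^sub>R e'"
      by (auto simp: conic_hull_explicit)
    moreover have "a \<bullet> e = 1" "a \<bullet> e' = 1"
      using e by (auto simp: extreme_point_of_def B_def)
    ultimately show "e = e'"
      by simp
  qed
  then have "finite {x. x extreme_point_of B}"
    by (rule inj_on_finite[OF _ _ fin]) (auto simp: ray)
  then have "polyhedron (convex_cone hull {x. x extreme_point_of B})"
    by (rule polyhedron_convex_cone_hull)
  moreover have "convex_cone hull {x. x extreme_point_of B} = K"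
  proof
    show "convex_cone hull {x. x extreme_point_of B} \<subseteq> K"
      using K(2) by (intro hull_minimal) (auto simp: extreme_point_of_def B_def)
    show "K \<subseteq> convex_cone hull {x. x extreme_point_of B}"
    proof
      fix x assume x: "x \<in> K"
      let ?H = "convex_cone hull {x. x extreme_point_of B}"
      have H: "convex_cone ?H"
        by (rule convex_cone_convex_cone_hull)
      have BH: "B \<subseteq> ?H"
        by (subst BE, rule hull_minimal) (use H in \<open>auto simp: convex_cone_def hull_inc\<close>)
      show "x \<in> ?H"
      proof (cases "x = 0")
        case True
        then show ?thesis
          using H convex_cone_contains_0 by blast
      next
        case False
        then have "(a \<bullet> x) *\<^sub>R ((1 / (a \<bullet> x)) *\<^sub>R x) \<in> ?H"
          using H BH scaled[OF x False] pos[OF x False]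
          by (meson convex_cone_scaleR less_imp_le subsetD)
        moreover have "a \<bullet> x \<noteq> 0"
          using pos[OF x False] by simp
        ultimately show ?thesis
          by simp
      qed
    qed
  qed
  ultimately have "polyhedron K" by simp
  then obtain H where H: "finite H" "K = \<Inter>H" "\<forall>h\<in>H. \<exists>a b. a \<noteq> 0 \<and> h = {x. a \<bullet> x \<le> b}"
    unfolding polyhedron_def by blast
  have "\<forall>h\<in>H. \<exists>p. h = {x. fst p \<bullet> x \<le> snd p}"
    using H(3) by fastforce
  then obtain p where p: "\<forall>h\<in>H. h = {x. fst (p h) \<bullet> x \<le> snd (p h)}"
    using bchoice[of H "\<lambda>h p. h = {x. fst p \<bullet> x \<le> snd p}"] by blast
  define n c where "n h = fst (p h)" and "c h = snd (p h)" for h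
  have nc: "x \<in> h \<longleftrightarrow> n h \<bullet> x \<le> c h" if "h \<in> H" for h x
    unfolding n_def c_def using p that by blast
  \<comment> \<open>The half-spaces come with arbitrary offsets \<open>c h\<close>. Since
    \<open>K\<close> is closed under nonnegative scaling, every offset may be replaced by 0.\<close>
  have c0: "0 \<le> c h" if "h \<in> H" for h
    using convex_cone_contains_0[OF K(2)] H(2) nc[OF that, of 0] that by auto
  have n0: "n h \<bullet> x \<le> 0" if h: "h \<in> H" and x: "x \<in> K" for h x
  proof (rule ccontr)
    assume "\<not> n h \<bullet> x \<le> 0"
    then have pos: "0 < n h \<bullet> x" by simp
    \<comment> \<open>This multiple of \<open>x\<close> has value \<open>c h + 1\<close> under
      \<open>n h\<close>, just outside the half-space.\<close>
    define r where "r = (c h + 1) / (n h \<bullet> x)"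
    have "r *\<^sub>R x \<in> K"
      using c0[OF h] pos x K(2) by (intro convex_cone_scaleR) (auto simp: r_def)
    then have "n h \<bullet> (r *\<^sub>R x) \<le> c h"
      using H(2) h nc[OF h] by blast
    then show False
      using pos by (simp add: r_def)
  qed
  have "K = {x. \<forall>f\<in>(\<lambda>h. - n h) ` H. 0 \<le> f \<bullet> x}"
  proof
    show "K \<subseteq> {x. \<forall>f\<in>(\<lambda>h. - n h) ` H. 0 \<le> f \<bullet> x}"
      using n0 by auto
    show "{x. \<forall>f\<in>(\<lambda>h. - n h) ` H. 0 \<le> f \<bullet> x} \<subseteq> K"
    proof
      fix x assume "x \<in> {x. \<forall>f\<in>(\<lambda>h. - n h) ` H. 0 \<le> f \<bullet> x}"
      then have "\<And>h. h \<in> H \<Longrightarrow> n h \<bullet> x \<le> c h"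
        using c0 by force
      then show "x \<in> K"
        using H(2) nc by blast
    qed
  qed
  then show ?thesis
    using that[of "(\<lambda>h. - n h) ` H"] H(1) by blast
qed

section \<open>Fitting decomposition and resolvent\<close>

lemma linear_funpow:
  fixes f :: "'a::real_vector \<Rightarrow> 'a"
  assumes "linear f"
  shows "linear (f ^^ n)"
proof (induction n)
  case 0
  show ?case by (simp add: linear_id[unfolded id_def] id_def)
next
  case (Suc n)
  then show ?case
    using linear_compose[OF Suc assms] by (simp add: o_def)
qed

text \<open>Take \<open>k\<close> with kernel of largest dimension. A smaller exponent has a smaller
  kernel, and a larger one has a kernel of the same dimension, hence the same kernel.\<close>

lemma kernel_funpow_stabilizes:
  fixes f :: "'a::euclidean_space \<Rightarrow> 'a"
  assumes "linear f"
  obtains k where "\<And>j x. (f ^^ j) x = 0 \<Longrightarrow> (f ^^ k) x = 0"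
proof -
  let ?N = "\<lambda>j. {x. (f ^^ j) x = 0}"
  have sub: "subspace (?N j)" for j
    by (rule linear_subspace_kernel[OF linear_funpow[OF assms]])
  have "\<exists>k. \<forall>j. dim (?N j) \<le> dim (?N k)"
  proof -
    have "\<forall>j. dim (?N j) < DIM('a) + 1"
      by (simp add: dim_subset_UNIV less_Suc_eq_le)
    then show ?thesis
      using ex_has_greatest_nat[of "\<lambda>_. True" 0 "\<lambda>j. dim (?N j)" "DIM('a) + 1"]
      by (auto dest: less_imp_le)
  qed
  then obtain k where k: "\<And>j. dim (?N j) \<le> dim (?N k)"
    by blast
  have "(f ^^ k) x = 0" if "(f ^^ j) x = 0" for j x
  proof (cases "j \<le> k")
    case True
    then have "(f ^^ k) x = (f ^^ (k - j)) ((f ^^ j) x)"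
      by (metis comp_apply funpow_add le_add_diff_inverse2)
    then show ?thesis
      using that linear_0[OF linear_funpow[OF assms]] by simp
  next
    case False
    have "?N k \<subseteq> ?N j"
    proof
      fix y assume "y \<in> ?N k"
      moreover have "(f ^^ j) y = (f ^^ (j - k)) ((f ^^ k) y)"
        using False by (metis comp_apply funpow_add le_add_diff_inverse2 nat_le_linear)
      ultimately show "y \<in> ?N j"
        using linear_0[OF linear_funpow[OF assms]] by simp
    qed
    then have "?N k = ?N j"
      using sub k by (intro subspace_dim_equal) auto
    then show ?thesis
      using that by blast
  qed
  then show ?thesis using that by blast
qed

text \<open>Stability makes \<open>f ^^ k\<close> injective on its own range, hence onto that range.
  So \<open>(f ^^ k) x\<close> has a preimage \<open>w\<close> in the range, and
  \<open>x - w\<close> is in the kernel.\<close>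

lemma fitting_decomposition:
  fixes f :: "'a::euclidean_space \<Rightarrow> 'a"
  assumes f: "linear f" and k: "\<And>j x. (f ^^ j) x = 0 \<Longrightarrow> (f ^^ k) x = 0"
  obtains e w where "x = e + w" "(f ^^ k) e = 0" "w \<in> range (f ^^ k)"
proof -
  let ?g = "f ^^ k"
  have g: "linear ?g" by (rule linear_funpow[OF f])
  have sub: "subspace (range ?g)"
    using linear_subspace_image[OF g subspace_UNIV] .
  have inj: "v = 0" if v: "v \<in> range ?g" "?g v = 0" for v
  proof -
    obtain u where u: "v = ?g u" using v by blast
    then have "(f ^^ (k + k)) u = 0"
      using v by (simp add: funpow_add)
    then show ?thesis
      using k u by blast
  qed
  have "inj_on ?g (range ?g)"
    using inj linear_inj_on_iff_eq_0[OF g sub] by blast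
  then have "dim (?g ` range ?g) = dim (range ?g)"
    using sub by (intro dim_image_eq[OF g]) (simp add: span_eq_iff[THEN iffD2])
  then have "?g ` range ?g = range ?g"
    using sub linear_subspace_image[OF g sub] by (intro subspace_dim_equal) auto
  then obtain w where w: "w \<in> range ?g" "?g x = ?g w"
    by blast
  then have "?g (x - w) = 0"
    using linear_diff[OF g] by simp
  then show ?thesis
    using that[of "x - w" w] w by simp
qed

section \<open>Limits in a small parameter and growth of iterates\<close>

lemma obtain_dominating_multiple:
  fixes h b :: "'a \<Rightarrow> real"
  assumes "finite S" "\<And>f. f \<in> S \<Longrightarrow> 0 < h f"
  obtains C where "0 < C" "\<And>f. f \<in> S \<Longrightarrow> b f < C * h f"
proof -
  have "\<forall>\<^sub>F C in at_top. b f < C * h f" if "f \<in> S" for f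
  proof -
    have "\<forall>\<^sub>F C in at_top. b f / h f < C"
      by (rule eventually_gt_at_top)
    then show ?thesis
      by eventually_elim (use assms(2)[OF that] in \<open>simp add: field_simps\<close>)
  qed
  then have "\<forall>\<^sub>F C in at_top. \<forall>f\<in>S. b f < C * h f"
    using assms(1) by (simp add: eventually_ball_finite)
  then have "\<forall>\<^sub>F C in at_top. 0 < C \<and> (\<forall>f\<in>S. b f < C * h f)"
    using eventually_gt_at_top[of "0::real"] by eventually_elim auto
  then show ?thesis
    using that eventually_happens'[OF trivial_limit_at_top_linorder] by blast
qed

text \<open>For positive \<open>s\<close> this is \<open>s ^ Suc d\<close> times the sum of a
  principal part with pole order at most \<open>Suc d\<close> and a constant \<open>M\<close>
  bounding the regular part. The limit isolates the leading coefficient.\<close>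

lemma tendsto_leading_coefficient:
  fixes c :: "nat \<Rightarrow> real"
  shows "((\<lambda>s. (\<Sum>j\<le>d. s ^ (d - j) * c j) + s ^ Suc d * M) \<longlongrightarrow> c d) (at_right 0)"
proof -
  have "isCont (\<lambda>s. (\<Sum>j\<le>d. s ^ (d - j) * c j) + s ^ Suc d * M) (0::real)"
    by (intro continuous_intros)
  then have "((\<lambda>s. (\<Sum>j\<le>d. s ^ (d - j) * c j) + s ^ Suc d * M)
      \<longlongrightarrow> (\<Sum>j\<le>d. 0 ^ (d - j) * c j) + 0 ^ Suc d * M) (at_right 0)"
    by (auto simp: isCont_def intro: tendsto_within_subset)
  moreover have "(\<Sum>j\<le>d. 0 ^ (d - j) * c j) = c d"
  proof -
    have "(\<Sum>j\<le>d. 0 ^ (d - j) * c j) = (\<Sum>j\<le>d. if j = d then c d else 0)"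
      by (intro sum.cong) auto
    then show ?thesis by simp
  qed
  ultimately show ?thesis by simp
qed

text \<open>Induction on \<open>p\<close>: passing from \<open>N\<close> to \<open>Suc N\<close>
  multiplies by \<open>lam\<close> and adds an iterate of \<open>f x\<close>, which the induction
  hypothesis bounds. The gap \<open>t - lam\<close> absorbs this error.\<close>

lemma funpow_norm_growth:
  fixes L f :: "'a::real_normed_vector \<Rightarrow> 'a"
  assumes L: "linear L" and f: "\<And>x. L x = lam *\<^sub>R x + f x" and lam: "0 \<le> lam" "lam < t"
    and "(f ^^ p) x = 0"
  shows "\<exists>C. \<forall>N. norm ((L ^^ N) x) \<le> C * t ^ N"
  using \<open>(f ^^ p) x = 0\<close>
proof (induction p arbitrary: x)
  case 0
  then show ?case
    using linear_0[OF linear_funpow[OF L]] by (intro exI[of _ 0]) simp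
next
  case (Suc p)
  then have "(f ^^ p) (f x) = 0"
    by (simp add: funpow_swap1)
  then obtain C' where C': "\<And>N. norm ((L ^^ N) (f x)) \<le> C' * t ^ N"
    using Suc.IH by blast
  \<comment> \<open>The first entry serves \<open>N = 0\<close>; the second is what the induction
    step in \<open>N\<close> requires.\<close>
  define C where "C = max (norm x) (C' / (t - lam))"
  have "C' / (t - lam) \<le> C" by (simp add: C_def)
  then have C: "lam * C + C' \<le> C * t"
    using lam by (simp add: field_simps)
  have "norm ((L ^^ N) x) \<le> C * t ^ N" for N
  proof (induction N)
    case 0
    show ?case by (simp add: C_def)
  next
    case (Suc N)
    have "(L ^^ Suc N) x = (L ^^ N) (lam *\<^sub>R x + f x)"
      by (simp only: funpow_Suc_right o_apply f)
    also have "\<dots> = lam *\<^sub>R (L ^^ N) x + (L ^^ N) (f x)"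
      by (simp add: linear_add linear_scale linear_funpow[OF L])
    finally have "norm ((L ^^ Suc N) x) \<le> lam * norm ((L ^^ N) x) + norm ((L ^^ N) (f x))"
      using lam by (metis norm_triangle_ineq norm_scaleR abs_of_nonneg)
    also have "\<dots> \<le> lam * (C * t ^ N) + C' * t ^ N"
      using Suc C' lam by (intro add_mono mult_left_mono) auto
    also have "\<dots> = (lam * C + C') * t ^ N"
      by (simp add: algebra_simps)
    also have "\<dots> \<le> (C * t) * t ^ N"
      using C lam by (intro mult_right_mono) auto
    finally show ?case by (simp add: algebra_simps)
  qed
  then show ?case by blast
qed

section \<open>Positivity of the resolvent at a shifted parameter\<close>

locale shifted_map =
  fixes L D :: "'a::euclidean_space \<Rightarrow> 'a" and lam :: real and k :: nat
  assumes linear_D: "linear D"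
    and L_eq: "\<And>x. L x = lam *\<^sub>R x + D x"
    and lam_nonneg: "0 \<le> lam"
    and stable: "\<And>j x. (D ^^ j) x = 0 \<Longrightarrow> (D ^^ k) x = 0"
begin

lemma linear_Dn: "linear (D ^^ n)"
  by (rule linear_funpow[OF linear_D])

lemma linear_L: "linear L"
proof (rule linearI)
  show "L (x + y) = L x + L y" for x y
    by (simp add: L_eq linear_add[OF linear_D] scaleR_add_right)
  show "L (c *\<^sub>R x) = c *\<^sub>R L x" for c x
    by (simp add: L_eq linear_scale[OF linear_D] scaleR_add_right scaleR_left_commute)
qed

lemma linear_Ln: "linear (L ^^ n)"
  by (rule linear_funpow[OF linear_L])

lemma Dn_zero_mono: "(D ^^ i) x = 0 \<Longrightarrow> i \<le> j \<Longrightarrow> (D ^^ j) x = 0"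
  by (metis comp_apply funpow_add le_add_diff_inverse2 linear_0 linear_Dn)

text \<open>This says that the local spectral radius of \<open>L\<close> at \<open>x\<close> is at
  most \<open>lam\<close>, which makes the Neumann series at \<open>lam + s\<close> converge for
  every \<open>s > 0\<close>. It is a condition on single vectors because the spectral radius of
  \<open>L\<close> itself may exceed \<open>lam\<close>.\<close>

definition tame :: "'a \<Rightarrow> bool" where
  "tame x \<longleftrightarrow> (\<forall>t>lam. \<exists>c. \<forall>N. norm ((L ^^ N) x) \<le> c * t ^ N)"

lemma tame_generalized: "(D ^^ p) x = 0 \<Longrightarrow> tame x"
  unfolding tame_def by (intro allI impI funpow_norm_growth[OF linear_L L_eq lam_nonneg])

lemma tame_add:
  assumes "tame x" "tame y"
  shows "tame (x + y)"
  unfolding tame_def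
proof (intro allI impI)
  fix t assume t: "lam < t"
  obtain a b where ab: "\<And>N. norm ((L ^^ N) x) \<le> a * t ^ N" "\<And>N. norm ((L ^^ N) y) \<le> b * t ^ N"
    using assms t unfolding tame_def by meson
  have "norm ((L ^^ N) (x + y)) \<le> (a + b) * t ^ N" for N
    using norm_triangle_le[OF add_mono[OF ab(1)[of N] ab(2)[of N]]]
    by (simp add: linear_add[OF linear_Ln] distrib_right)
  then show "\<exists>c. \<forall>N. norm ((L ^^ N) (x + y)) \<le> c * t ^ N"
    by blast
qed

lemma tame_uminus: "tame x \<Longrightarrow> tame (- x)"
  by (simp add: tame_def linear_neg[OF linear_Ln])

text \<open>
  The vector \<open>y\<close> below is \<open>(s I - D)\<^sup>-\<^sup>1 g\<close>: the sum is its principal part at \<open>s = 0\<close>, the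
  contribution of the generalized eigenspace, and the rest is bounded. It belongs to the cone
  because it is the Neumann series of \<open>((lam + s) I - L)\<^sup>-\<^sup>1 g\<close>.
\<close>

lemma resolvent_in_cone:
  assumes C: "closed C" "convex_cone C" "\<And>x. x \<in> C \<Longrightarrow> L x \<in> C"
    and g: "g \<in> C" "tame g"
    and dec: "g = e + w" "(D ^^ k) e = 0" "w \<in> range (D ^^ k)"
  shows "\<exists>M. \<forall>\<^sub>F s in at_right 0. \<exists>y. norm y \<le> M \<and>
           (\<Sum>j<k. (1 / s ^ Suc j) *\<^sub>R (D ^^ j) e) + y \<in> C"
proof -
  let ?W = "range (D ^^ k)"
  have W: "subspace ?W"
    using linear_subspace_image[OF linear_Dn subspace_UNIV] .
  have DW: "D v \<in> ?W" if "v \<in> ?W" for v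
    using that by (metis (no_types, lifting) funpow_swap1 image_iff rangeI)
  have inj: "v = 0" if v: "v \<in> ?W" "D v = 0" for v
  proof -
    obtain u where u: "v = (D ^^ k) u" using v by blast
    then have "(D ^^ Suc k) u = 0"
      using v by simp
    then show ?thesis
      using stable u by blast
  qed
  obtain c where c: "0 < c" "\<And>v. v \<in> ?W \<Longrightarrow> c * norm v \<le> norm (D v)"
    using injective_imp_isometric[of ?W D] W inj linear_D
    by (auto simp: closed_subspace linear_conv_bounded_linear mult.commute)
  define M where "M = 2 / c * norm w"
  have "\<exists>y. norm y \<le> M \<and> (\<Sum>j<k. (1 / s ^ Suc j) *\<^sub>R (D ^^ j) e) + y \<in> C"
    if s: "0 < s" "s < c / 2" for s
  proof -
    define S where "S v = s *\<^sub>R v - D v" for v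
    have linS: "linear S"
      unfolding S_def by (intro linear_compose_sub linear_D linear_scaleR)
    have SW: "S v \<in> ?W" if "v \<in> ?W" for v
      unfolding S_def using that DW W by (simp add: subspace_diff subspace_scale)
    \<comment> \<open>The restriction \<open>s < c / 2\<close> gives a lower bound independent of
      \<open>s\<close>, so that one \<open>M\<close> bounds the regular part for all these
      \<open>s\<close>.\<close>
    have lowW: "c / 2 * norm v \<le> norm (S v)" if "v \<in> ?W" for v
    proof -
      have "s * norm v \<le> c / 2 * norm v"
        using s by (intro mult_right_mono) auto
      moreover have "norm (D v) \<le> norm (S v) + s * norm v"
        using norm_triangle_ineq4[of "s *\<^sub>R v" "S v"] s by (simp add: S_def)
      ultimately show ?thesis
        using c(2)[OF that] by (simp add: field_simps)
    qed
    have S0W: "v = 0" if "v \<in> ?W" "S v = 0" for v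
      using lowW[OF that(1)] that(2) c(1) by (simp add: mult_le_0_iff)
    have "dim (S ` ?W) = dim ?W"
      using S0W W linear_inj_on_iff_eq_0[OF linS W]
      by (intro dim_image_eq[OF linS]) (simp add: span_eq_iff[THEN iffD2])
    then have "S ` ?W = ?W"
      using SW W linear_subspace_image[OF linS W] by (intro subspace_dim_equal) auto
    then obtain y1 where y1: "y1 \<in> ?W" "S y1 = w"
      using dec(3) by (metis (no_types, lifting) imageE)
    have y1M: "norm y1 \<le> M"
      using lowW[OF y1(1)] c(1) by (simp add: M_def y1(2) field_simps)
    \<comment> \<open>A kernel vector of \<open>S\<close> satisfies \<open>D v = s v\<close> with
      \<open>s\<close> nonzero, so it lies in the range of \<open>D ^^ k\<close>, where
      \<open>S\<close> is already known to be injective.\<close>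
    have S0: "v = 0" if "S v = 0" for v
    proof -
      have Dv: "D v = s *\<^sub>R v"
        using that by (simp add: S_def)
      have "(D ^^ n) v = s ^ n *\<^sub>R v" for n
        by (induction n) (simp_all add: linear_scale[OF linear_D] Dv mult.commute)
      then have "v = (D ^^ k) ((1 / s ^ k) *\<^sub>R v)"
        using s by (simp add: linear_scale[OF linear_Dn])
      then show ?thesis
        using S0W that by blast
    qed
    then have "inj S"
      using linear_injective_0[OF linS] by blast
    then obtain B where B: "0 < B" "\<And>v. B * norm v \<le> norm (S v)"
      using linear_inj_bounded_below_pos[OF linS] by blast
    define es where "es = (\<Sum>j<k. (1 / s ^ Suc j) *\<^sub>R (D ^^ j) e)"
    have "S es = (\<Sum>j<k. (1 / s ^ j) *\<^sub>R (D ^^ j) e - (1 / s ^ Suc j) *\<^sub>R (D ^^ Suc j) e)"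
      unfolding es_def linear_sum[OF linS]
      using s by (intro sum.cong) (simp_all add: S_def linear_scale[OF linear_D])
    also have "\<dots> = e"
      by (subst sum_lessThan_telescope') (simp add: dec(2))
    finally have Sy: "S (es + y1) = g"
      using y1(2) dec(1) by (simp add: linear_add[OF linS])
    define t where "t = lam + s"
    have t: "0 < t" using s lam_nonneg by (simp add: t_def)
    have S_t: "S v = t *\<^sub>R v - L v" for v
      by (simp add: S_def L_eq t_def scaleR_add_left)
    have LnC: "(L ^^ n) g \<in> C" for n
      by (induction n) (use C(3) g(1) in auto)
    define y where "y N = (\<Sum>i<N. (1 / t ^ Suc i) *\<^sub>R (L ^^ i) g)" for N
    have yC: "y N \<in> C" for N
    proof (induction N)
      case 0
      show ?case using convex_cone_contains_0[OF C(2)] by (simp add: y_def)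
    next
      case (Suc N)
      have "(1 / t ^ Suc N) *\<^sub>R (L ^^ N) g \<in> C"
        using t LnC by (intro convex_cone_scaleR[OF C(2)]) auto
      then show ?case
        using convex_cone_add[OF C(2) Suc] by (simp add: y_def)
    qed
    have "S (y N) = (\<Sum>i<N. (1 / t ^ i) *\<^sub>R (L ^^ i) g - (1 / t ^ Suc i) *\<^sub>R (L ^^ Suc i) g)" for N
      unfolding y_def linear_sum[OF linS]
      using t by (intro sum.cong) (simp_all add: S_t linear_scale[OF linear_L] scaleR_diff_right)
    then have SyN: "S (y N) = g - (1 / t ^ N) *\<^sub>R (L ^^ N) g" for N
      using sum_lessThan_telescope'[of "\<lambda>i. (1 / t ^ i) *\<^sub>R (L ^^ i) g" N] by simp
    \<comment> \<open>Any rate strictly between \<open>lam\<close> and \<open>t\<close> would do: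
      tameness then bounds the error of the partial sums by a multiple of
      \<open>(u / t) ^ N\<close>.\<close>
    define u where "u = lam + s / 2"
    have u: "0 < u" "u < t" "lam < u"
      using s lam_nonneg by (auto simp: u_def t_def)
    obtain b where "\<forall>N. norm ((L ^^ N) g) \<le> b * u ^ N"
      using g(2)[unfolded tame_def, rule_format, OF u(3)] ..
    then have b: "norm ((L ^^ N) g) \<le> b * u ^ N" for N ..
    have bound: "norm (y N - (es + y1)) \<le> (b / B) * (u / t) ^ N" for N
    proof -
      have "S (y N - (es + y1)) = - ((1 / t ^ N) *\<^sub>R (L ^^ N) g)"
        by (simp add: linear_diff[OF linS] SyN Sy)
      then have "B * norm (y N - (es + y1)) \<le> norm ((L ^^ N) g) / t ^ N"
        using B(2)[of "y N - (es + y1)"] t by simp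
      also have "\<dots> \<le> b * u ^ N / t ^ N"
        using b t by (intro divide_right_mono) auto
      finally have "norm (y N - (es + y1)) \<le> b * u ^ N / t ^ N / B"
        using B(1) by (subst pos_le_divide_eq) (simp_all only: mult.commute[of _ B])
      then show ?thesis
        by (simp add: power_divide mult.commute)
    qed
    have "(\<lambda>N. (b / B) * (u / t) ^ N) \<longlonglongrightarrow> 0"
      using u t by (intro tendsto_mult_right_zero LIMSEQ_power_zero) auto
    then have "(\<lambda>N. y N - (es + y1)) \<longlonglongrightarrow> 0"
      by (rule Lim_null_comparison[rotated]) (use bound in auto)
    then have "y \<longlonglongrightarrow> es + y1"
      by (rule LIM_zero_cancel)
    then have "es + y1 \<in> C"
      using closed_sequentially[OF C(1), of y "es + y1"] yC by simp
    then show ?thesis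
      using y1M unfolding es_def by blast
  qed
  then show ?thesis
    unfolding eventually_at_right_field using c(1)
    by (intro exI[of _ M] exI[of _ "c / 2"]) auto
qed

text \<open>Apply \<open>f\<close> to the resolvent vector in the cone and multiply by
  \<open>s ^ Suc d\<close>. Poles of higher order vanish under \<open>f\<close>, and what remains
  tends to the coefficient in question as \<open>s\<close> decreases to 0.\<close>

lemma leading_nonneg:
  assumes C: "closed C" "convex_cone C" "\<And>x. x \<in> C \<Longrightarrow> L x \<in> C"
    and g: "g \<in> C" "tame g"
    and dec: "g = e + w" "(D ^^ k) e = 0" "w \<in> range (D ^^ k)"
    and f: "\<And>x. x \<in> C \<Longrightarrow> 0 \<le> f \<bullet> x" "\<And>j. d < j \<Longrightarrow> f \<bullet> (D ^^ j) e = 0"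
  shows "0 \<le> f \<bullet> (D ^^ d) e"
proof (cases "d < k")
  case False
  then show ?thesis
    using Dn_zero_mono[OF dec(2), of d] by simp
next
  case True
  obtain M where M: "\<forall>\<^sub>F s in at_right 0. \<exists>y. norm y \<le> M \<and>
           (\<Sum>j<k. (1 / s ^ Suc j) *\<^sub>R (D ^^ j) e) + y \<in> C"
    using resolvent_in_cone[OF C g dec] by blast
  define c where "c j = f \<bullet> (D ^^ j) e" for j
  have "\<forall>\<^sub>F s in at_right 0. 0 \<le> (\<Sum>j\<le>d. s ^ (d - j) * c j) + s ^ Suc d * (norm f * M)"
    using M eventually_at_right_less[of "0::real"]
  proof eventually_elim
    case (elim s)
    then obtain y where y: "norm y \<le> M" "(\<Sum>j<k. (1 / s ^ Suc j) *\<^sub>R (D ^^ j) e) + y \<in> C"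
      by blast
    have "f \<bullet> y \<le> norm f * M"
      using norm_cauchy_schwarz[of f y] y(1) by (meson mult_left_mono norm_ge_zero order_trans)
    moreover have "0 \<le> f \<bullet> ((\<Sum>j<k. (1 / s ^ Suc j) *\<^sub>R (D ^^ j) e) + y)"
      using f(1) y(2) by blast
    ultimately have "0 \<le> (\<Sum>j<k. (1 / s ^ Suc j) * c j) + norm f * M"
      by (simp add: inner_add_right inner_sum_right c_def)
    moreover have "(\<Sum>j<k. (1 / s ^ Suc j) * c j) = (\<Sum>j\<le>d. (1 / s ^ Suc j) * c j)"
      using True f(2) by (intro sum.mono_neutral_right) (auto simp: c_def)
    ultimately have "0 \<le> s ^ Suc d * ((\<Sum>j\<le>d. (1 / s ^ Suc j) * c j) + norm f * M)"
      using elim by (simp only:) (intro mult_nonneg_nonneg, auto)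
    also have "\<dots> = (\<Sum>j\<le>d. s ^ (d - j) * c j) + s ^ Suc d * (norm f * M)"
    proof -
      have "s ^ Suc d * ((1 / s ^ Suc j) * c j) = s ^ (d - j) * c j" if "j \<le> d" for j
        using elim that by (simp add: power_diff)
      then show ?thesis
        unfolding distrib_left sum_distrib_left by simp
    qed
    finally show ?case .
  qed
  then have "0 \<le> c d"
    by (rule tendsto_lowerbound[OF tendsto_leading_coefficient]) simp
  then show ?thesis
    by (simp add: c_def)
qed

end

section \<open>Invariant faces of a polyhedral cone\<close>

text \<open>After the factor \<open>s ^ (k - Suc d)\<close> is taken out, the constant term is
  \<open>c d\<close>.\<close>

lemma eventually_polynomial_pos:
  fixes c :: "nat \<Rightarrow> real"
  assumes "d < k" "0 < c d" "\<And>j. d < j \<Longrightarrow> c j = 0"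
  shows "\<forall>\<^sub>F s in at_right 0. 0 < (\<Sum>j<k. s ^ (k - Suc j) * c j)"
proof -
  have "\<forall>\<^sub>F s in at_right 0. 0 < (\<Sum>j\<le>d. s ^ (d - j) * c j) + s ^ Suc d * 0"
    using order_tendstoD(1)[OF tendsto_leading_coefficient[of d c 0] assms(2)] .
  then show ?thesis
    using eventually_at_right_less[of "0::real"]
  proof eventually_elim
    case (elim s)
    have "(\<Sum>j<k. s ^ (k - Suc j) * c j) = (\<Sum>j\<le>d. s ^ (k - Suc j) * c j)"
      using assms by (intro sum.mono_neutral_right) auto
    also have "\<dots> = (\<Sum>j\<le>d. s ^ (k - Suc d) * (s ^ (d - j) * c j))"
    proof (intro sum.cong refl)
      fix j assume "j \<in> {..d}"
      then have "k - Suc j = (k - Suc d) + (d - j)"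
        using assms(1) by simp
      then show "s ^ (k - Suc j) * c j = s ^ (k - Suc d) * (s ^ (d - j) * c j)"
        by (simp add: power_add)
    qed
    also have "\<dots> = s ^ (k - Suc d) * (\<Sum>j\<le>d. s ^ (d - j) * c j)"
      by (simp add: sum_distrib_left)
    finally show ?case
      using elim by simp
  qed
qed

lemma obtain_last_nonzero:
  fixes c :: "nat \<Rightarrow> 'b::zero"
  assumes "c i \<noteq> 0" "\<And>j. k \<le> j \<Longrightarrow> c j = 0"
  obtains d where "i \<le> d" "d < k" "c d \<noteq> 0" "\<And>j. d < j \<Longrightarrow> c j = 0"
proof -
  let ?S = "{j. c j \<noteq> 0}"
  have "?S \<subseteq> {..<k}"
    using assms(2) by (auto simp: not_less[symmetric])
  then have fin: "finite ?S"
    using finite_subset by blast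
  have "Max ?S \<in> ?S"
    using assms(1) fin by (intro Max_in) auto
  moreover have le: "j \<le> Max ?S" if "c j \<noteq> 0" for j
    using fin that by simp
  moreover have "c j = 0" if "Max ?S < j" for j
    using le[of j] that by (cases "c j = 0") auto
  ultimately show ?thesis
    using that[of "Max ?S"] le[OF assms(1)] \<open>?S \<subseteq> {..<k}\<close> by blast
qed

lemma convex_cone_sum:
  assumes "convex_cone S" "\<And>i. i \<in> I \<Longrightarrow> v i \<in> S"
  shows "sum v I \<in> S"
  using assms(2)
  by (induction I rule: infinite_finite_induct)
    (auto intro: convex_cone_contains_0[OF assms(1)] convex_cone_add[OF assms(1)])

text \<open>The elements of \<open>K\<close> lying below some \<open>g + h\<close> in the cone order
  form a face that includes \<open>G\<close> and \<open>H\<close>, so this face includes the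
  join.\<close>

lemma face_join_dominated:
  assumes K: "convex_cone K" and G: "cone_face K G" and H: "cone_face K H"
    and w: "w \<in> face_join K G H"
  obtains g h where "g \<in> G" "h \<in> H" "g + h - w \<in> K"
proof -
  let ?J = "{w \<in> K. \<exists>g\<in>G. \<exists>h\<in>H. g + h - w \<in> K}"
  have cG: "convex_cone G" "G \<subseteq> K" and cH: "convex_cone H" "H \<subseteq> K"
    using G H by (auto simp: cone_face_def)
  have zero: "0 \<in> G" "0 \<in> H" "0 \<in> K"
    using cG cH K convex_cone_contains_0 by blast+
  have "cone_face K ?J"
    unfolding cone_face_def
  proof (intro conjI ballI impI)
    show "convex_cone ?J"
      unfolding convex_cone_iff
    proof (intro conjI ballI allI impI)
      show "0 \<in> ?J"
        using zero by force
    next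
      fix x y assume x: "x \<in> ?J" and y: "y \<in> ?J"
      obtain g h where gh: "g \<in> G" "h \<in> H" "g + h - x \<in> K"
        using x by blast
      obtain g' h' where gh': "g' \<in> G" "h' \<in> H" "g' + h' - y \<in> K"
        using y by blast
      have "(g + h - x) + (g' + h' - y) \<in> K"
        by (rule convex_cone_add[OF K gh(3) gh'(3)])
      then have "(g + g') + (h + h') - (x + y) \<in> K"
        by (simp add: algebra_simps)
      moreover have "g + g' \<in> G" "h + h' \<in> H" "x + y \<in> K"
        using gh gh' x y cG cH K by (auto intro: convex_cone_add)
      ultimately show "x + y \<in> ?J"
        by blast
    next
      fix x and c :: real assume x: "x \<in> ?J" and c: "0 \<le> c"
      obtain g h where gh: "g \<in> G" "h \<in> H" "g + h - x \<in> K"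
        using x by blast
      have "c *\<^sub>R (g + h - x) \<in> K"
        by (rule convex_cone_scaleR[OF K c gh(3)])
      then have "c *\<^sub>R g + c *\<^sub>R h - c *\<^sub>R x \<in> K"
        by (simp add: algebra_simps)
      moreover have "c *\<^sub>R g \<in> G" "c *\<^sub>R h \<in> H" "c *\<^sub>R x \<in> K"
        using gh x c cG cH K by (auto intro: convex_cone_scaleR)
      ultimately show "c *\<^sub>R x \<in> ?J"
        by blast
    qed
    show "?J \<subseteq> K"
      by blast
    have below: "x \<in> ?J" if xy: "x \<in> K" "y \<in> K" "x + y \<in> ?J" for x y
    proof -
      obtain g h where gh: "g \<in> G" "h \<in> H" "g + h - (x + y) \<in> K"
        using xy(3) by blast
      have "(g + h - (x + y)) + y \<in> K"
        by (rule convex_cone_add[OF K gh(3) xy(2)])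
      then have "g + h - x \<in> K"
        by (simp add: algebra_simps)
      then show ?thesis
        using gh xy(1) by blast
    qed
    fix x y assume "x \<in> K" "y \<in> K" "x + y \<in> ?J"
    then show "x \<in> ?J" "y \<in> ?J"
      using below[of x y] below[of y x] by (simp_all add: add.commute)
  qed
  moreover have "G \<union> H \<subseteq> ?J"
  proof
    fix v assume "v \<in> G \<union> H"
    then show "v \<in> ?J"
    proof
      assume v: "v \<in> G"
      have "v + 0 - v \<in> K" using zero by simp
      then show ?thesis
        using v zero cG(2) by blast
    next
      assume v: "v \<in> H"
      have "0 + v - v \<in> K" using zero by simp
      then show ?thesis
        using v zero cH(2) by blast
    qed
  qed
  ultimately have "w \<in> ?J"
    using face_join_smallest(3)[OF K G H] w by blast
  then show ?thesis
    using that by blast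
qed

text \<open>\<open>strictly_positive\<close> is a quantitative form of pointedness.\<close>

locale polyhedral_cone_map = shifted_map "(*v) A" D lam k
  for A :: "real ^ 'n ^ 'n" and D lam k +
  fixes K Fs :: "(real ^ 'n) set"
  assumes finite_Fs: "finite Fs"
    and K_eq: "K = {x. \<forall>f\<in>Fs. 0 \<le> f \<bullet> x}"
    and A_K: "\<And>x. x \<in> K \<Longrightarrow> A *v x \<in> K"
    and strictly_positive: "\<exists>a b. 0 < b \<and> (\<forall>x\<in>K. b * norm x \<le> a \<bullet> x)"
begin

lemma mem_K: "x \<in> K \<longleftrightarrow> (\<forall>f\<in>Fs. 0 \<le> f \<bullet> x)"
  by (simp add: K_eq)

lemma convex_cone_K: "convex_cone K"
  by (auto simp: convex_cone_iff mem_K inner_add_right)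

lemma closed_K: "closed K"
proof -
  have "K = (\<Inter>f\<in>Fs. {x. 0 \<le> f \<bullet> x})"
    by (auto simp: mem_K)
  then show ?thesis
    by (simp add: closed_INT closed_halfspace_ge)
qed

lemma pointed:
  assumes "\<And>f. f \<in> Fs \<Longrightarrow> f \<bullet> x = 0"
  shows "x = 0"
proof -
  obtain a b where ab: "0 < b" "\<And>x. x \<in> K \<Longrightarrow> b * norm x \<le> a \<bullet> x"
    using strictly_positive by blast
  have "x \<in> K" "- x \<in> K"
    using assms by (auto simp: mem_K)
  then have "b * norm x \<le> 0"
    using ab(2)[of x] ab(2)[of "- x"] by simp
  then show ?thesis
    using ab(1) by (simp add: mult_le_0_iff)
qed

lemma funpow_A_K: "x \<in> K \<Longrightarrow> ((*v) A ^^ N) x \<in> K"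
  by (induction N) (auto intro: A_K)

lemma cone_face_K: "cone_face K K"
  by (simp add: cone_face_def convex_cone_K)

lemma invariant_face_K: "invariant_face A K K"
  using cone_face_K A_K by (auto simp: invariant_face_def)

section \<open>Faces described by facet functionals\<close>

lemma face_dominated:
  assumes F: "cone_face K F" and "v \<in> F" "w \<in> K" "C *\<^sub>R v - w \<in> K" "0 \<le> C"
  shows "w \<in> F"
proof -
  have "w + (C *\<^sub>R v - w) \<in> F"
    using assms by (auto simp: cone_face_def intro: convex_cone_scaleR)
  then show ?thesis
    using assms unfolding cone_face_def by blast
qed

text \<open>For \<open>v\<close> in \<open>K\<close> this is the smallest face containing
  \<open>v\<close>. Encoding it by the functionals that vanish at \<open>v\<close> makes closedness
  immediate and reduces membership to finitely many equations.\<close>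

definition gen_face :: "real ^ 'n \<Rightarrow> (real ^ 'n) set" where
  "gen_face v = {w \<in> K. \<forall>f\<in>Fs. f \<bullet> v = 0 \<longrightarrow> f \<bullet> w = 0}"

lemma gen_face_refl: "v \<in> K \<Longrightarrow> v \<in> gen_face v"
  by (simp add: gen_face_def)

lemma cone_face_gen_face: "cone_face K (gen_face v)"
  unfolding cone_face_def
proof (intro conjI ballI impI)
  show "convex_cone (gen_face v)"
    by (auto simp: convex_cone_iff gen_face_def mem_K inner_add_right)
  show "gen_face v \<subseteq> K"
    by (auto simp: gen_face_def)
  fix x y assume xy: "x \<in> K" "y \<in> K" "x + y \<in> gen_face v"
  have "f \<bullet> x = 0 \<and> f \<bullet> y = 0" if "f \<in> Fs" "f \<bullet> v = 0" for f
    using xy that by (auto simp: gen_face_def inner_add_right mem_K add_nonneg_eq_0_iff)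
  then show "x \<in> gen_face v" "y \<in> gen_face v"
    using xy by (auto simp: gen_face_def)
qed

lemma closed_gen_face: "closed (gen_face v)"
proof -
  have "gen_face v = K \<inter> (\<Inter>f\<in>{f \<in> Fs. f \<bullet> v = 0}. {w. f \<bullet> w = 0})"
    by (auto simp: gen_face_def)
  then show ?thesis
    by (auto intro!: closed_Int closed_INT closed_K closed_hyperplane)
qed

text \<open>A functional vanishing at \<open>v\<close> also vanishes at \<open>w\<close>. On the
  finitely many others \<open>v\<close> is positive, so one large multiple of \<open>v\<close>
  exceeds \<open>w\<close> on all of them.\<close>

lemma gen_face_dominated:
  assumes "v \<in> K" "w \<in> gen_face v"
  obtains C where "0 < C" "C *\<^sub>R v - w \<in> K"
proof -
  let ?S = "{f \<in> Fs. 0 < f \<bullet> v}"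
  have fin: "finite ?S" and pos: "\<And>f. f \<in> ?S \<Longrightarrow> 0 < f \<bullet> v"
    using finite_Fs by auto
  obtain C where C: "0 < C" "\<And>f. f \<in> ?S \<Longrightarrow> f \<bullet> w < C * (f \<bullet> v)"
    using obtain_dominating_multiple[of ?S "\<lambda>f. f \<bullet> v" "\<lambda>f. f \<bullet> w", OF fin pos] by blast
  have "0 \<le> f \<bullet> (C *\<^sub>R v - w)" if f: "f \<in> Fs" for f
  proof (cases "f \<bullet> v = 0")
    case True
    then show ?thesis
      using assms f by (simp add: gen_face_def inner_diff_right)
  next
    case False
    then have "0 < f \<bullet> v"
      using assms(1) f by (auto simp: mem_K less_le)
    then show ?thesis
      using C(2)[of f] f by (simp add: inner_diff_right)
  qed
  then show ?thesis
    using that C(1) by (simp add: mem_K)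
qed

lemma gen_face_subset:
  assumes "cone_face K F" "v \<in> F"
  shows "gen_face v \<subseteq> F"
proof
  fix w assume w: "w \<in> gen_face v"
  have "v \<in> K"
    using assms by (auto simp: cone_face_def)
  then obtain C where "0 < C" "C *\<^sub>R v - w \<in> K"
    using w gen_face_dominated by blast
  then show "w \<in> F"
    using w by (intro face_dominated[OF assms]) (auto simp: gen_face_def)
qed

text \<open>Testing the generator suffices: if \<open>w\<close> lies below \<open>C v\<close>, then
  \<open>A w\<close> lies below \<open>C (A v)\<close>, so a functional vanishing at
  \<open>A v\<close> vanishes at \<open>A w\<close> too.\<close>

lemma invariant_gen_face:
  assumes "v \<in> K" "\<And>f. f \<in> Fs \<Longrightarrow> f \<bullet> v = 0 \<Longrightarrow> f \<bullet> (A *v v) = 0"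
  shows "invariant_face A K (gen_face v)"
  unfolding invariant_face_def
proof (intro conjI cone_face_gen_face image_subsetI)
  fix w assume w: "w \<in> gen_face v"
  then have wK: "w \<in> K" by (simp add: gen_face_def)
  obtain C where C: "0 < C" "C *\<^sub>R v - w \<in> K"
    using gen_face_dominated[OF assms(1) w] by blast
  have "f \<bullet> (A *v w) = 0" if f: "f \<in> Fs" "f \<bullet> v = 0" for f
  proof -
    have "0 \<le> f \<bullet> (A *v (C *\<^sub>R v - w))"
      using A_K[OF C(2)] f(1) by (simp add: mem_K)
    also have "\<dots> = - (f \<bullet> (A *v w))"
      using assms(2)[OF f] by (simp add: linear_diff[OF linear_L] linear_scale[OF linear_L] inner_diff_right)
    finally show ?thesis
      using A_K[OF wK] f(1) by (auto simp: mem_K)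
  qed
  then show "A *v w \<in> gen_face v"
    using A_K[OF wK] by (simp add: gen_face_def)
qed

text \<open>Since \<open>w\<close> lies below \<open>C v\<close>, the segment from \<open>w\<close>
  to \<open>v\<close> can be prolonged past \<open>v\<close> by the fraction \<open>1 / C\<close> of
  its length without leaving the face.\<close>

lemma rel_interior_gen_face:
  assumes "v \<in> K"
  shows "v \<in> rel_interior (gen_face v)"
proof -
  have conv: "convex (gen_face v)"
    using cone_face_gen_face by (auto simp: cone_face_def convex_cone_def)
  have "\<exists>e>1. (1 - e) *\<^sub>R w + e *\<^sub>R v \<in> gen_face v" if w: "w \<in> gen_face v" for w
  proof -
    obtain C where C: "0 < C" "C *\<^sub>R v - w \<in> K"
      using gen_face_dominated[OF assms w] by blast
    define e where "e = 1 + 1 / C"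
    have "(1 - e) *\<^sub>R w + e *\<^sub>R v = (1 / C) *\<^sub>R (C *\<^sub>R v - w + v)"
      using C(1) by (simp add: e_def scaleR_add_left scaleR_diff_right scaleR_add_right)
    moreover have "\<dots> \<in> K"
      using C assms by (intro convex_cone_add convex_cone_scaleR convex_cone_K) auto
    moreover have "f \<bullet> ((1 - e) *\<^sub>R w + e *\<^sub>R v) = 0" if "f \<in> Fs" "f \<bullet> v = 0" for f
      using w that by (simp add: gen_face_def inner_add_right)
    ultimately show ?thesis
      using C(1) by (intro exI[of _ e]) (auto simp: gen_face_def e_def)
  qed
  moreover have "gen_face v \<noteq> {}"
    using gen_face_refl[OF assms] by blast
  ultimately show ?thesis
    using convex_rel_interior_iff[OF conv] by blast
qed

text \<open>A segment from \<open>w\<close> can be prolonged past \<open>x\<close> inside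
  \<open>F\<close>. A nonnegative functional that is 0 at \<open>x\<close> would become negative
  there unless it is 0 at \<open>w\<close>.\<close>

lemma face_eq_gen_face:
  assumes F: "cone_face K F" and x: "x \<in> rel_interior F"
  shows "F = gen_face x"
proof
  have FK: "F \<subseteq> K" and conv: "convex F" and xF: "x \<in> F"
    using F x rel_interior_subset by (auto simp: cone_face_def convex_cone_def)
  show "gen_face x \<subseteq> F"
    by (rule gen_face_subset[OF F xF])
  show "F \<subseteq> gen_face x"
  proof
    fix w assume w: "w \<in> F"
    then obtain e where e: "1 < e" "(1 - e) *\<^sub>R w + e *\<^sub>R x \<in> F"
      using convex_rel_interior_iff[OF conv] x by blast
    have "f \<bullet> w = 0" if f: "f \<in> Fs" "f \<bullet> x = 0" for f
    proof -
      have "0 \<le> f \<bullet> ((1 - e) *\<^sub>R w + e *\<^sub>R x)"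
        using e(2) FK f(1) mem_K by blast
      then have "0 \<le> (1 - e) * (f \<bullet> w)"
        using f(2) by (simp add: inner_add_right)
      moreover have "0 \<le> f \<bullet> w"
        using w FK f(1) mem_K by blast
      ultimately show ?thesis
        using e(1) by (simp add: zero_le_mult_iff)
    qed
    then show "w \<in> gen_face x"
      using w FK by (auto simp: gen_face_def)
  qed
qed

text \<open>For each functional that does not vanish on \<open>F\<close>, add an element of
  \<open>F\<close> where it is nonzero; nonnegativity rules out cancellation in the sum.\<close>

lemma face_generator:
  assumes F: "cone_face K F"
  obtains g where "g \<in> F" "F = gen_face g"
proof -
  have cc: "convex_cone F" and FK: "F \<subseteq> K"
    using F by (auto simp: cone_face_def)
  have "\<exists>g\<in>F. \<forall>f\<in>S. f \<bullet> g = 0 \<longrightarrow> (\<forall>v\<in>F. f \<bullet> v = 0)" if "S \<subseteq> Fs" for S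
    using finite_subset[OF that finite_Fs] that
  proof (induction S rule: finite_induct)
    case empty
    show ?case using convex_cone_contains_0[OF cc] by blast
  next
    case (insert f S)
    then obtain g where g: "g \<in> F" "\<And>f. f \<in> S \<Longrightarrow> f \<bullet> g = 0 \<Longrightarrow> \<forall>v\<in>F. f \<bullet> v = 0"
      by auto
    show ?case
    proof (cases "\<forall>v\<in>F. f \<bullet> v = 0")
      case True
      then show ?thesis using g by blast
    next
      case False
      then obtain v where v: "v \<in> F" "f \<bullet> v \<noteq> 0" by blast
      have "h \<bullet> g = 0 \<and> h \<bullet> v = 0" if "h \<in> insert f S" "h \<bullet> (g + v) = 0" for h
      proof -
        have "h \<in> Fs" "g \<in> K" "v \<in> K"
          using that(1) insert.prems g(1) v(1) FK by auto
        then have "0 \<le> h \<bullet> g" "0 \<le> h \<bullet> v"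
          by (auto simp: mem_K)
        then show ?thesis
          using that(2) by (simp add: inner_add_right)
      qed
      then have "\<forall>h\<in>insert f S. h \<bullet> (g + v) = 0 \<longrightarrow> (\<forall>v\<in>F. h \<bullet> v = 0)"
        using g(2) v(2) by blast
      then show ?thesis
        using convex_cone_add[OF cc g(1) v(1)] by blast
    qed
  qed
  from this[OF order_refl]
  obtain g where g: "g \<in> F" "\<And>f. f \<in> Fs \<Longrightarrow> f \<bullet> g = 0 \<Longrightarrow> \<forall>v\<in>F. f \<bullet> v = 0"
    by blast
  then have "F \<subseteq> gen_face g"
    using FK by (auto simp: gen_face_def)
  then show ?thesis
    using that g(1) gen_face_subset[OF F g(1)] by blast
qed

text \<open>Powers of \<open>A\<close> preserve the cone order, so the iterates of \<open>g\<close>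
  stay below \<open>C\<close> times those of \<open>x\<close>; the strictly positive functional
  converts this into a norm bound.\<close>

lemma tame_dominated:
  assumes "tame x" "x \<in> K" "g \<in> K" "0 \<le> C" "C *\<^sub>R x - g \<in> K"
  shows "tame g"
  unfolding tame_def
proof (intro allI impI)
  fix t assume t: "lam < t"
  obtain c where c: "\<forall>N. norm (((*v) A ^^ N) x) \<le> c * t ^ N"
    using assms(1)[unfolded tame_def, rule_format, OF t] ..
  obtain a b where ab: "0 < b" "\<And>x. x \<in> K \<Longrightarrow> b * norm x \<le> a \<bullet> x"
    using strictly_positive by blast
  have "norm (((*v) A ^^ N) g) \<le> (C * norm a * c / b) * t ^ N" for N
  proof -
    let ?g = "((*v) A ^^ N) g" and ?x = "((*v) A ^^ N) x"
    have d: "C *\<^sub>R ?x - ?g \<in> K"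
      using funpow_A_K[OF assms(5), of N] by (simp add: linear_diff[OF linear_Ln] linear_scale[OF linear_Ln])
    have "b * norm ?g \<le> a \<bullet> ?g"
      by (rule ab(2)[OF funpow_A_K[OF assms(3)]])
    also have "\<dots> \<le> C * (a \<bullet> ?x)"
      using ab(2)[OF d] ab(1) by (simp add: inner_diff_right) (smt (verit) mult_nonneg_nonneg norm_ge_zero)
    also have "\<dots> \<le> C * (norm a * (c * t ^ N))"
      using assms(4) c norm_cauchy_schwarz[of a ?x]
      by (intro mult_left_mono) (meson mult_left_mono norm_ge_zero order_trans, simp)
    finally show ?thesis
      using ab(1) by (simp add: pos_le_divide_eq mult_ac)
  qed
  then show "\<exists>c. \<forall>N. norm (((*v) A ^^ N) g) \<le> c * t ^ N"
    by blast
qed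

section \<open>Jordan chains in the cone and monotonicity of the order\<close>

lemma generalized_leading_nonneg:
  assumes "x \<in> K" "(D ^^ k) x = 0" "f \<in> Fs" "\<And>j. d < j \<Longrightarrow> f \<bullet> (D ^^ j) x = 0"
  shows "0 \<le> f \<bullet> (D ^^ d) x"
proof (rule leading_nonneg[OF closed_K convex_cone_K A_K assms(1)])
  show "tame x"
    by (rule tame_generalized[OF assms(2)])
  show "x = x + 0" by simp
  show "0 \<in> range (D ^^ k)"
    using linear_0[OF linear_Dn] by (metis rangeI)
qed (use assms mem_K in auto)

text \<open>
  The condition on \<open>e\<close> says that for each facet functional the leading coefficient of the
  polynomial \<open>\<Sum>j. s\<^sup>k\<^sup>-\<^sup>1\<^sup>-\<^sup>j f (D\<^sup>j e)\<close> as \<open>s\<close> tends to \<open>0\<close> is positive, and the vector \<open>q\<close> is the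
  value of the polynomial \<open>\<Sum>j. s\<^sup>k\<^sup>-\<^sup>1\<^sup>-\<^sup>j D\<^sup>j e\<close> at a small \<open>s\<close>.
\<close>

lemma nonneg_jordan_chain:
  assumes e: "(D ^^ k) e = 0"
    and lead: "\<And>f d. f \<in> Fs \<Longrightarrow> (\<And>j. d < j \<Longrightarrow> f \<bullet> (D ^^ j) e = 0) \<Longrightarrow> 0 \<le> f \<bullet> (D ^^ d) e"
  obtains q where "\<And>i. (D ^^ i) q \<in> K"
    and "\<And>f i. f \<in> Fs \<Longrightarrow> f \<bullet> q = 0 \<Longrightarrow> f \<bullet> (D ^^ i) e = 0"
    and "\<And>f i. (\<And>j. f \<bullet> (D ^^ j) e = 0) \<Longrightarrow> f \<bullet> (D ^^ i) q = 0"
    and "\<And>i. (D ^^ i) q = 0 \<longleftrightarrow> (D ^^ i) e = 0"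
proof -
  \<comment> \<open>For the vector \<open>q\<close> built from the parameter \<open>s\<close>, this
    is the value of \<open>f\<close> at \<open>(D ^^ i) q\<close>.\<close>
  define P where "P s i f = (\<Sum>j<k. s ^ (k - Suc j) * (f \<bullet> (D ^^ (i + j)) e))" for s :: real and i f
  have pos: "\<forall>\<^sub>F s in at_right 0. 0 < P s i f" if f: "f \<in> Fs" and nz: "f \<bullet> (D ^^ (i + j)) e \<noteq> 0" for f i j
  proof -
    have zero: "f \<bullet> (D ^^ (i + j)) e = 0" if "k \<le> j" for j
      using Dn_zero_mono[OF e, of "i + j"] that by simp
    obtain d where d: "d < k" "f \<bullet> (D ^^ (i + d)) e \<noteq> 0" "\<And>j. d < j \<Longrightarrow> f \<bullet> (D ^^ (i + j)) e = 0"
      using obtain_last_nonzero[of "\<lambda>j. f \<bullet> (D ^^ (i + j)) e" j k] nz zero by blast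
    have "0 \<le> f \<bullet> (D ^^ (i + d)) e"
    proof (rule lead[OF f])
      fix m assume "i + d < m"
      then show "f \<bullet> (D ^^ m) e = 0"
        using d(3)[of "m - i"] by simp
    qed
    then show ?thesis
      unfolding P_def using d by (intro eventually_polynomial_pos[of d]) auto
  qed
  have "\<forall>\<^sub>F s in at_right 0. 0 \<le> P s i f \<and> (\<forall>j. f \<bullet> (D ^^ (i + j)) e \<noteq> 0 \<longrightarrow> 0 < P s i f)"
    if f: "f \<in> Fs" for f i
  proof (cases "\<exists>j. f \<bullet> (D ^^ (i + j)) e \<noteq> 0")
    case True
    then obtain j where "f \<bullet> (D ^^ (i + j)) e \<noteq> 0" by blast
    from pos[OF f this] show ?thesis
      by eventually_elim auto
  next
    case False
    then show ?thesis by (simp add: P_def)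
  qed
  \<comment> \<open>Only finitely many pairs of \<open>i\<close> and \<open>f\<close> have to be
    served by one \<open>s\<close>, since \<open>D ^^ i\<close> annihilates \<open>q\<close> for
    \<open>i \<ge> k\<close>.\<close>
  then have "\<forall>\<^sub>F s in at_right 0. \<forall>i\<in>{..<k}. \<forall>f\<in>Fs.
      0 \<le> P s i f \<and> (\<forall>j. f \<bullet> (D ^^ (i + j)) e \<noteq> 0 \<longrightarrow> 0 < P s i f)"
    using finite_Fs by (intro eventually_ball_finite) (auto intro!: eventually_ball_finite)
  then have "\<forall>\<^sub>F s in at_right 0. 0 < s \<and> (\<forall>i\<in>{..<k}. \<forall>f\<in>Fs.
      0 \<le> P s i f \<and> (\<forall>j. f \<bullet> (D ^^ (i + j)) e \<noteq> 0 \<longrightarrow> 0 < P s i f))"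
    using eventually_at_right_less[of "0::real"] by eventually_elim auto
  then obtain s where s0: "0 < s \<and> (\<forall>i\<in>{..<k}. \<forall>f\<in>Fs.
      0 \<le> P s i f \<and> (\<forall>j. f \<bullet> (D ^^ (i + j)) e \<noteq> 0 \<longrightarrow> 0 < P s i f))"
    using eventually_happens'[OF trivial_limit_at_right_real] by blast
  then have s: "0 < s" and sP: "\<And>i f. i < k \<Longrightarrow> f \<in> Fs \<Longrightarrow> 0 \<le> P s i f"
    "\<And>i f j. i < k \<Longrightarrow> f \<in> Fs \<Longrightarrow> f \<bullet> (D ^^ (i + j)) e \<noteq> 0 \<Longrightarrow> 0 < P s i f"
    by auto
  define q where "q = (\<Sum>j<k. s ^ (k - Suc j) *\<^sub>R (D ^^ j) e)"
  have Dq: "(D ^^ i) q = (\<Sum>j<k. s ^ (k - Suc j) *\<^sub>R (D ^^ (i + j)) e)" for i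
    by (simp add: q_def linear_sum[OF linear_Dn] linear_scale[OF linear_Dn] funpow_add)
  have fq: "f \<bullet> (D ^^ i) q = P s i f" for f i
    by (simp add: Dq P_def inner_sum_right)
  have Dqk: "(D ^^ i) q = 0" if "k \<le> i" for i
    unfolding Dq using that by (intro sum.neutral) (auto simp: Dn_zero_mono[OF e])
  \<comment> \<open>Up to the factor \<open>s ^ k\<close>, \<open>q\<close> is the resolvent of
    \<open>D\<close> at \<open>s\<close> applied to \<open>e\<close>. This identity recovers
    \<open>e\<close> from \<open>q\<close> by an operator commuting with \<open>D\<close>, so
    whatever power of \<open>D\<close> kills \<open>q\<close> kills \<open>e\<close>.\<close>
  have "s *\<^sub>R q - D q = (\<Sum>j<k. s ^ (k - j) *\<^sub>R (D ^^ j) e - s ^ (k - Suc j) *\<^sub>R (D ^^ Suc j) e)"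
  proof -
    have "s * s ^ (k - Suc j) = s ^ (k - j)" if "j < k" for j
      using that by (simp flip: power_Suc add: Suc_diff_Suc)
    then show ?thesis
      by (simp add: q_def linear_sum[OF linear_D] linear_scale[OF linear_D] scaleR_sum_right sum_subtractf)
  qed
  also have "\<dots> = s ^ k *\<^sub>R e"
    using sum_lessThan_telescope'[of "\<lambda>j. s ^ (k - j) *\<^sub>R (D ^^ j) e" k] e by simp
  finally have se: "s ^ k *\<^sub>R e = s *\<^sub>R q - D q" by simp
  show ?thesis
  proof (rule that)
    show "(D ^^ i) q \<in> K" for i
      using sP(1)[of i] Dqk[of i] fq by (cases "i < k") (auto simp: mem_K)
    show "f \<bullet> (D ^^ i) e = 0" if "f \<in> Fs" "f \<bullet> q = 0" for f i
    proof (cases "k = 0")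
      case True
      then show ?thesis using Dn_zero_mono[OF e, of i] by simp
    next
      case False
      then show ?thesis
        using sP(2)[of 0 f i] that fq[of f 0] by (cases "f \<bullet> (D ^^ i) e = 0") auto
    qed
    show "f \<bullet> (D ^^ i) q = 0" if "\<And>j. f \<bullet> (D ^^ j) e = 0" for f i
      by (simp add: fq P_def that)
    show "(D ^^ i) q = 0 \<longleftrightarrow> (D ^^ i) e = 0" for i
    proof
      assume *: "(D ^^ i) q = 0"
      have "s ^ k *\<^sub>R (D ^^ i) e = (D ^^ i) (s ^ k *\<^sub>R e)"
        by (simp add: linear_scale[OF linear_Dn])
      also have "\<dots> = s *\<^sub>R (D ^^ i) q - D ((D ^^ i) q)"
        by (simp add: se linear_diff[OF linear_Dn] linear_scale[OF linear_Dn] funpow_swap1)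
      also have "\<dots> = 0"
        by (simp add: * linear_0[OF linear_D])
      finally show "(D ^^ i) e = 0"
        using s by simp
    next
      assume "(D ^^ i) e = 0"
      then show "(D ^^ i) q = 0"
        unfolding Dq by (intro sum.neutral) (simp add: Dn_zero_mono)
    qed
  qed
qed

text \<open>Let \<open>d\<close> be the last exponent with \<open>(D ^^ d) q\<close> nonzero. If
  \<open>d \<ge> p\<close>, then \<open>y\<close> contributes nothing at \<open>d\<close> or beyond,
  so the leading coefficients of \<open>q\<close> and of \<open>y - q + w\<close> are opposite. Both
  are nonnegative under every functional, and pointedness forces them to be 0.\<close>

lemma dominated_order:
  assumes q: "q \<in> K" "(D ^^ k) q = 0" and u: "y - q + w \<in> K" "tame (y - q + w)"
    and y: "(D ^^ p) y = 0" and w: "w \<in> range (D ^^ k)"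
  shows "(D ^^ p) q = 0"
proof (rule ccontr)
  assume "(D ^^ p) q \<noteq> 0"
  from obtain_last_nonzero[of "\<lambda>j. (D ^^ j) q", OF this Dn_zero_mono[OF q(2)]]
  obtain d where d: "p \<le> d" "(D ^^ d) q \<noteq> 0" "\<And>j. d < j \<Longrightarrow> (D ^^ j) q = 0"
    by blast
  have Dy: "(D ^^ j) (y - q) = - (D ^^ j) q" if "d \<le> j" for j
    using Dn_zero_mono[OF y, of j] d(1) that by (simp add: linear_diff[OF linear_Dn])
  have k: "(D ^^ k) (y - q) = 0"
    using stable[OF y] q(2) by (simp add: linear_diff[OF linear_Dn])
  have "f \<bullet> (D ^^ d) q = 0" if f: "f \<in> Fs" for f
  proof -
    have "0 \<le> f \<bullet> (D ^^ d) q"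
      using generalized_leading_nonneg[OF q f] d(3) by simp
    moreover have "0 \<le> f \<bullet> (D ^^ d) (y - q)"
    proof (rule leading_nonneg[OF closed_K convex_cone_K A_K u refl k w])
      show "0 \<le> f \<bullet> x" if "x \<in> K" for x
        using that f by (simp add: mem_K)
      show "f \<bullet> (D ^^ j) (y - q) = 0" if "d < j" for j
        using that d(3) by (simp add: Dy)
    qed
    ultimately show ?thesis
      by (simp add: Dy)
  qed
  then show False
    using pointed d(2) by blast
qed

lemma gen_face_order:
  assumes "x \<in> K" "(D ^^ p) x = 0" "g \<in> gen_face x" "(D ^^ k) g = 0"
  shows "(D ^^ p) g = 0"
proof -
  obtain C where C: "0 < C" "C *\<^sub>R x - g \<in> K"
    using gen_face_dominated[OF assms(1,3)] by blast
  have 1: "(D ^^ p) (C *\<^sub>R x) = 0"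
    using assms(2) by (simp add: linear_scale[OF linear_Dn])
  have 2: "(D ^^ k) (C *\<^sub>R x - g) = 0"
    using stable[OF 1] assms(4) by (simp add: linear_diff[OF linear_Dn])
  show ?thesis
    by (rule dominated_order[of g "C *\<^sub>R x" 0])
      (use assms C 1 2 in \<open>auto simp: gen_face_def tame_generalized intro: range_eqI[of _ _ 0] linear_0[OF linear_Dn, symmetric]\<close>)
qed

section \<open>Generalized eigenvectors and their orders in terms of \<open>D\<close>\<close>

lemma annihilated_iff: "annihilated A lam j x \<longleftrightarrow> (D ^^ j) x = 0"
proof -
  \<comment> \<open>The two maps differ by a sign, so their iterates have the same kernels.\<close>
  have step: "(mat lam - A) *v v = - D v" for v
  proof -
    have "mat lam *v v = lam *\<^sub>R v"
      by (simp add: vec_eq_iff matrix_vector_mult_def mat_def if_distrib[of "\<lambda>a. a * b" for b] cong: if_cong)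
    then show ?thesis
      using L_eq[of v] by (simp add: matrix_vector_mult_diff_rdistrib)
  qed
  have "((*v) (mat lam - A) ^^ j) x = (- 1) ^ j *\<^sub>R (D ^^ j) x"
    by (induction j) (simp_all add: step linear_scale[OF linear_D])
  then show ?thesis
    by (simp add: annihilated_def)
qed

lemma generalized_eigenvector_iff:
  "generalized_eigenvector A lam x \<longleftrightarrow> x \<noteq> 0 \<and> (D ^^ k) x = 0"
proof
  assume "generalized_eigenvector A lam x"
  then show "x \<noteq> 0 \<and> (D ^^ k) x = 0"
    using stable by (auto simp: generalized_eigenvector_def annihilated_iff)
next
  assume *: "x \<noteq> 0 \<and> (D ^^ k) x = 0"
  then have "(D ^^ Suc k) x = 0"
    by (simp add: linear_0[OF linear_D])
  then show "generalized_eigenvector A lam x"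
    unfolding generalized_eigenvector_def annihilated_iff using * by blast
qed

lemma eigenvector_order_Suc:
  assumes "generalized_eigenvector A lam x"
  obtains p where "eigenvector_order A lam x = Suc p" "(D ^^ Suc p) x = 0" "(D ^^ p) x \<noteq> 0" "p < k"
proof -
  have x: "x \<noteq> 0" "(D ^^ k) x = 0"
    using assms by (auto simp: generalized_eigenvector_iff)
  let ?Q = "\<lambda>j. 0 < j \<and> (D ^^ j) x = 0"
  define m where "m = (LEAST j. ?Q j)"
  have m_eq: "eigenvector_order A lam x = m"
    by (simp add: eigenvector_order_def m_def annihilated_iff)
  obtain j where "?Q j"
    using assms by (auto simp: generalized_eigenvector_def annihilated_iff)
  then have m: "?Q m"
    unfolding m_def by (rule LeastI)
  then obtain p where p: "m = Suc p"
    using gr0_conv_Suc by auto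
  have nz: "(D ^^ p) x \<noteq> 0"
  proof (cases "p = 0")
    case True
    then show ?thesis using x by simp
  next
    case False
    have "\<not> ?Q p"
      by (rule not_less_Least) (simp add: p flip: m_def)
    then show ?thesis
      using False by simp
  qed
  have "p < k"
    using nz Dn_zero_mono[OF x(2), of p] by (cases "p < k") auto
  then show ?thesis
    using that[of p] m_eq p m nz by simp
qed

text \<open>Here \<open>g\<close> need not be a generalized eigenvector: the chain is built from its
  component \<open>e\<close> in the generalized eigenspace, which itself may lie outside
  \<open>G\<close>. The chain stays in \<open>G\<close> because functionals vanishing on
  \<open>G\<close> vanish on all iterates of \<open>e\<close>.\<close>

lemma chain_in_invariant_face:
  assumes G: "invariant_face A K G" and g: "g \<in> G" "tame g"
    and dec: "g = e + w" "(D ^^ k) e = 0" "w \<in> range (D ^^ k)"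
  obtains q where "\<And>i. (D ^^ i) q \<in> G"
    and "\<And>f i. f \<in> Fs \<Longrightarrow> f \<bullet> q = 0 \<Longrightarrow> f \<bullet> (D ^^ i) e = 0"
    and "\<And>f i. f \<in> Fs \<Longrightarrow> f \<bullet> q = 0 \<Longrightarrow> f \<bullet> (D ^^ i) q = 0"
    and "\<And>i. (D ^^ i) q = 0 \<longleftrightarrow> (D ^^ i) e = 0"
    and "invariant_face A K (gen_face q)"
proof -
  have face: "cone_face K G" and GK: "G \<subseteq> K" and cc: "convex_cone G"
    and AG: "\<And>x. x \<in> G \<Longrightarrow> A *v x \<in> G"
    using G by (auto simp: invariant_face_def cone_face_def)
  obtain v where v: "v \<in> G" "G = gen_face v"
    using face_generator[OF face] by blast
  have cl: "closed G"
    using v closed_gen_face by simp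
  have lead: "0 \<le> f \<bullet> (D ^^ d) e"
    if "\<And>x. x \<in> G \<Longrightarrow> 0 \<le> f \<bullet> x" "\<And>j. d < j \<Longrightarrow> f \<bullet> (D ^^ j) e = 0" for f d
    by (rule leading_nonneg[OF cl cc AG g dec that])
  \<comment> \<open>Both \<open>f\<close> and \<open>- f\<close> are nonnegative on
    \<open>G\<close>, so the last nonzero coefficient would have to be both nonnegative and
    nonpositive.\<close>
  have vanish: "f \<bullet> (D ^^ j) e = 0" if f: "\<And>x. x \<in> G \<Longrightarrow> f \<bullet> x = 0" for f j
  proof (rule ccontr)
    assume nz: "f \<bullet> (D ^^ j) e \<noteq> 0"
    have "f \<bullet> (D ^^ i) e = 0" if "k \<le> i" for i
      using Dn_zero_mono[OF dec(2) that] by simp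
    from obtain_last_nonzero[of "\<lambda>j. f \<bullet> (D ^^ j) e", OF nz this]
    obtain d where d: "f \<bullet> (D ^^ d) e \<noteq> 0" "\<And>j. d < j \<Longrightarrow> f \<bullet> (D ^^ j) e = 0"
      by blast
    have "0 \<le> f \<bullet> (D ^^ d) e" "0 \<le> (- f) \<bullet> (D ^^ d) e"
      by (rule lead; simp add: f d(2))+
    then show False
      using d(1) by simp
  qed
  have leadK: "0 \<le> f \<bullet> (D ^^ d) e"
    if "f \<in> Fs" "\<And>j. d < j \<Longrightarrow> f \<bullet> (D ^^ j) e = 0" for f d
    using that GK mem_K by (intro lead) auto
  obtain q where q: "\<And>i. (D ^^ i) q \<in> K"
    "\<And>f i. f \<in> Fs \<Longrightarrow> f \<bullet> q = 0 \<Longrightarrow> f \<bullet> (D ^^ i) e = 0"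
    "\<And>f i. (\<And>j. f \<bullet> (D ^^ j) e = 0) \<Longrightarrow> f \<bullet> (D ^^ i) q = 0"
    "\<And>i. (D ^^ i) q = 0 \<longleftrightarrow> (D ^^ i) e = 0"
    using nonneg_jordan_chain[OF dec(2) leadK] by blast
  have qG: "(D ^^ i) q \<in> G" for i
  proof -
    have "f \<bullet> (D ^^ i) q = 0" if f: "f \<in> Fs" "f \<bullet> v = 0" for f
      by (rule q(3), rule vanish) (use v(2) f in \<open>auto simp: gen_face_def\<close>)
    then show ?thesis
      using q(1) unfolding v(2) by (simp add: gen_face_def)
  qed
  have qq: "f \<bullet> (D ^^ i) q = 0" if "f \<in> Fs" "f \<bullet> q = 0" for f i
    by (rule q(3), rule q(2)[OF that])
  have "invariant_face A K (gen_face q)"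
  proof (rule invariant_gen_face)
    show "q \<in> K" using q(1)[of 0] by simp
    show "f \<bullet> (A *v q) = 0" if "f \<in> Fs" "f \<bullet> q = 0" for f
      using qq[OF that, of 1] that(2) by (simp add: L_eq inner_add_right)
  qed
  then show ?thesis
    using that qG q(2,4) qq by blast
qed

text \<open>
  Hence each generalized eigenvector in an invariant face can be replaced by one of the same order
  whose whole Jordan chain under \<open>D\<close> lies in that face.
\<close>

lemma generalized_chain_in_invariant_face:
  assumes G: "invariant_face A K G" and x: "x \<in> G" "(D ^^ k) x = 0"
  obtains q where "\<And>i. (D ^^ i) q \<in> G"
    and "\<And>f i. f \<in> Fs \<Longrightarrow> f \<bullet> q = 0 \<Longrightarrow> f \<bullet> (D ^^ i) x = 0"
    and "\<And>f i. f \<in> Fs \<Longrightarrow> f \<bullet> q = 0 \<Longrightarrow> f \<bullet> (D ^^ i) q = 0"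
    and "\<And>i. (D ^^ i) q = 0 \<longleftrightarrow> (D ^^ i) x = 0"
    and "invariant_face A K (gen_face q)"
proof (rule chain_in_invariant_face[OF G x(1) tame_generalized[OF x(2)] _ x(2)])
  show "x = x + 0" by simp
  show "0 \<in> range (D ^^ k)"
    using linear_0[OF linear_Dn] by (metis rangeI)
qed (use that in blast)

text \<open>
  If the order did not drop, then modulo \<open>n0\<close> the vectors \<open>x'\<close> and \<open>y'\<close> would both be eigenvectors,
  and subtracting from \<open>x'\<close> the largest possible multiple of \<open>y'\<close> would produce a proper invariant
  face whose join with \<open>G\<close> is \<open>F\<close>.
\<close>

lemma join_irreducible_order:
  assumes F: "invariant_join_irreducible A K F" and x: "x \<in> rel_interior F" "(D ^^ Suc p) x = 0"
    and G: "invariant_face A K G" "G \<subset> F" and y: "y \<in> G" "(D ^^ k) y = 0"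
  shows "(D ^^ p) y = 0"
proof (rule ccontr)
  assume nz: "(D ^^ p) y \<noteq> 0"
  have Finv: "invariant_face A K F" and Fface: "cone_face K F" and FK: "F \<subseteq> K"
    using F by (auto simp: invariant_join_irreducible_def invariant_face_def cone_face_def)
  have Gface: "cone_face K G"
    using G by (simp add: invariant_face_def)
  have xF: "x \<in> F"
    using x(1) rel_interior_subset by blast
  obtain x' where x': "\<And>i. (D ^^ i) x' \<in> F"
    "\<And>f i. f \<in> Fs \<Longrightarrow> f \<bullet> x' = 0 \<Longrightarrow> f \<bullet> (D ^^ i) x = 0"
    "\<And>f i. f \<in> Fs \<Longrightarrow> f \<bullet> x' = 0 \<Longrightarrow> f \<bullet> (D ^^ i) x' = 0"
    "\<And>i. (D ^^ i) x' = 0 \<longleftrightarrow> (D ^^ i) x = 0"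
    "invariant_face A K (gen_face x')"
    by (rule generalized_chain_in_invariant_face[OF Finv xF stable[OF x(2)]]) (rule that)
  obtain y' where y': "\<And>i. (D ^^ i) y' \<in> G"
    "\<And>f i. f \<in> Fs \<Longrightarrow> f \<bullet> y' = 0 \<Longrightarrow> f \<bullet> (D ^^ i) y = 0"
    "\<And>f i. f \<in> Fs \<Longrightarrow> f \<bullet> y' = 0 \<Longrightarrow> f \<bullet> (D ^^ i) y' = 0"
    "\<And>i. (D ^^ i) y' = 0 \<longleftrightarrow> (D ^^ i) y = 0"
    "invariant_face A K (gen_face y')"
    by (rule generalized_chain_in_invariant_face[OF G(1) y]) (rule that)
  have x'F: "x' \<in> F" and x'K: "x' \<in> K" and y'G: "y' \<in> G" and y'F: "y' \<in> F" and y'K: "y' \<in> K"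
    using x'(1)[of 0] y'(1)[of 0] FK G(2) by auto
  have xx': "x \<in> gen_face x'"
    using xF FK x'(2)[of _ 0] by (auto simp: gen_face_def)
  have F_eq: "F = gen_face x'"
    using gen_face_subset[OF Fface x'F] gen_face_subset[OF cone_face_gen_face xx']
      face_eq_gen_face[OF Fface x(1)] by blast
  have F0: "f \<bullet> v = 0" if "f \<in> Fs" "f \<bullet> x' = 0" "v \<in> F" for f v
    using that unfolding F_eq by (simp add: gen_face_def)
  have Dx': "(D ^^ i) x' = 0" if "Suc p \<le> i" for i
    using x'(4) Dn_zero_mono[OF x(2) that] by simp
  have "(D ^^ Suc p) y' = 0"
    using gen_face_order[OF x'K Dx'[OF order_refl], of y'] y'F y'(4)[of k] y(2) F_eq by simp
  then have Dy': "(D ^^ i) y' = 0" if "Suc p \<le> i" for i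
    using Dn_zero_mono that by blast
  \<comment> \<open>\<open>n0\<close> collects all proper iterates of both chains. They lie in
    \<open>K\<close>, so a functional vanishing at the sum vanishes at every one of them.\<close>
  define n0 where "n0 = (\<Sum>i<k. (D ^^ Suc i) x' + (D ^^ Suc i) y')"
  have n0F: "n0 \<in> F"
  proof -
    have cc: "convex_cone F"
      using Fface by (simp add: cone_face_def)
    have "(D ^^ i) y' \<in> F" for i
      using y'(1) G(2) by blast
    then show ?thesis
      unfolding n0_def by (intro convex_cone_sum[OF cc] convex_cone_add[OF cc] x'(1))
  qed
  then have n0K: "n0 \<in> K"
    using FK by blast
  have n0_zero: "f \<bullet> (D ^^ Suc i) x' = 0 \<and> f \<bullet> (D ^^ Suc i) y' = 0"
    if f: "f \<in> Fs" "f \<bullet> n0 = 0" for f i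
  proof (cases "i < k")
    case True
    have nonneg: "0 \<le> f \<bullet> (D ^^ j) x'" "0 \<le> f \<bullet> (D ^^ j) y'" for j
      using f(1) x'(1)[of j] y'(1)[of j] G(2) FK mem_K by blast+
    let ?s = "\<lambda>i. f \<bullet> (D ^^ Suc i) x' + f \<bullet> (D ^^ Suc i) y'"
    have "sum ?s {..<k} = 0"
      using f(2) by (simp only: n0_def inner_sum_right inner_add_right)
    moreover have "0 \<le> ?s j" for j
      by (intro add_nonneg_nonneg nonneg)
    ultimately have "\<forall>j\<in>{..<k}. ?s j = 0"
      by (subst (asm) sum_nonneg_eq_0_iff) (simp_all del: funpow.simps)
    then have "?s i = 0"
      using True by blast
    then show ?thesis
      using nonneg[of "Suc i"] by linarith
  next
    case False
    have "(D ^^ k) x' = 0" "(D ^^ k) y' = 0"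
      using stable Dx' Dy' by blast+
    then show ?thesis
      using False Dn_zero_mono[of k x' "Suc i"] Dn_zero_mono[of k y' "Suc i"] by simp
  qed
  \<comment> \<open>Every summand already contains one \<open>D\<close>. As \<open>D ^^ p\<close>
    does not annihilate \<open>y'\<close>, monotonicity of the order keeps \<open>y'\<close> out of
    the face of \<open>n0\<close>, and the set \<open>S\<close> below is nonempty.\<close>
  have "(D ^^ p) n0 = 0"
  proof -
    have "(D ^^ p) ((D ^^ Suc i) v) = (D ^^ (p + Suc i)) v" for i v
      by (simp only: funpow_add o_apply)
    then show ?thesis
      unfolding n0_def linear_sum[OF linear_Dn] linear_add[OF linear_Dn]
      by (intro sum.neutral) (simp add: Dx' Dy' del: funpow.simps)
  qed
  moreover have "(D ^^ k) y' = 0" "(D ^^ p) y' \<noteq> 0"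
    using y'(4) y(2) nz by auto
  ultimately have "y' \<notin> gen_face n0"
    using gen_face_order[OF n0K] by blast
  then obtain f1 where f1: "f1 \<in> Fs" "f1 \<bullet> n0 = 0" "f1 \<bullet> y' \<noteq> 0"
    using y'K by (auto simp: gen_face_def)
  define S where "S = {f \<in> Fs. f \<bullet> n0 = 0 \<and> 0 < f \<bullet> y'}"
  \<comment> \<open>This is the largest multiple of \<open>y'\<close> that can be subtracted from
    \<open>x'\<close> while staying nonnegative on the functionals vanishing at \<open>n0\<close>;
    the minimum is attained at \<open>f0\<close>.\<close>
  define \<epsilon> where "\<epsilon> = Min ((\<lambda>f. (f \<bullet> x') / (f \<bullet> y')) ` S)"
  have "f1 \<in> S"
    using f1 y'K by (auto simp: S_def mem_K less_le)
  have fin: "finite ((\<lambda>f. (f \<bullet> x') / (f \<bullet> y')) ` S)"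
    using finite_Fs by (simp add: S_def)
  obtain f0 where f0: "f0 \<in> S" "\<epsilon> = (f0 \<bullet> x') / (f0 \<bullet> y')"
    using Min_in[OF fin] \<open>f1 \<in> S\<close> unfolding \<epsilon>_def by blast
  have f0x': "0 < f0 \<bullet> x'"
  proof -
    have "f0 \<in> Fs" "0 < f0 \<bullet> y'"
      using f0(1) by (auto simp: S_def)
    then have "f0 \<bullet> x' \<noteq> 0"
      using F0[OF _ _ y'F, of f0] by auto
    then show ?thesis
      using x'K \<open>f0 \<in> Fs\<close> by (auto simp: mem_K less_le)
  qed
  have eps: "0 < \<epsilon>" "f0 \<bullet> x' = \<epsilon> * (f0 \<bullet> y')"
    using f0 f0x' by (auto simp: S_def)
  have eps_le: "\<epsilon> * (f \<bullet> y') \<le> f \<bullet> x'" if "f \<in> Fs" "f \<bullet> n0 = 0" for f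
  proof (cases "f \<in> S")
    case True
    then have "\<epsilon> \<le> (f \<bullet> x') / (f \<bullet> y')"
      unfolding \<epsilon>_def using fin by simp
    then show ?thesis
      using True by (simp add: S_def pos_le_divide_eq)
  next
    case False
    then have "f \<bullet> y' = 0"
      using that y'K by (force simp: S_def mem_K)
    then show ?thesis
      using x'K that by (simp add: mem_K)
  qed
  let ?T = "{f \<in> Fs. 0 < f \<bullet> n0}"
  have finT: "finite ?T" and posT: "\<And>f. f \<in> ?T \<Longrightarrow> 0 < f \<bullet> n0"
    using finite_Fs by auto
  obtain C where C: "0 < C" "\<And>f. f \<in> ?T \<Longrightarrow> \<epsilon> * (f \<bullet> y') - f \<bullet> x' < C * (f \<bullet> n0)"
    using obtain_dominating_multiple[of ?T "\<lambda>f. f \<bullet> n0" "\<lambda>f. \<epsilon> * (f \<bullet> y') - f \<bullet> x'", OF finT posT] by blast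
  \<comment> \<open>The term in \<open>n0\<close> makes \<open>v\<close> strictly positive under the
    functionals positive at \<open>n0\<close>. Hence a functional vanishing at \<open>v\<close>
    vanishes at \<open>n0\<close> and so at all proper iterates, which makes the face of
    \<open>v\<close> invariant.\<close>
  define v where "v = x' - \<epsilon> *\<^sub>R y' + C *\<^sub>R n0"
  have fv: "f \<bullet> v = f \<bullet> x' - \<epsilon> * (f \<bullet> y') + C * (f \<bullet> n0)" for f
    by (simp add: v_def inner_add_right inner_diff_right)
  have fv_pos: "0 < f \<bullet> v" if "f \<in> Fs" "f \<bullet> n0 \<noteq> 0" for f
    using C(2)[of f] that n0K by (force simp: fv mem_K)
  have vK: "v \<in> K"
    unfolding mem_K
  proof
    fix f assume f: "f \<in> Fs"
    show "0 \<le> f \<bullet> v"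
      using fv_pos[OF f] eps_le[OF f] by (cases "f \<bullet> n0 = 0") (auto simp: fv)
  qed
  have Dv: "D v = D x' - \<epsilon> *\<^sub>R D y' + C *\<^sub>R (\<Sum>i<k. (D ^^ Suc (Suc i)) x' + (D ^^ Suc (Suc i)) y')"
    by (simp add: v_def n0_def linear_add[OF linear_D] linear_diff[OF linear_D]
        linear_scale[OF linear_D] linear_sum[OF linear_D])
  have Hinv: "invariant_face A K (gen_face v)"
  proof (rule invariant_gen_face[OF vK])
    fix f assume f: "f \<in> Fs" "f \<bullet> v = 0"
    then have "f \<bullet> n0 = 0"
      using fv_pos[OF f(1)] by auto
    note z = n0_zero[OF f(1) this]
    have "f \<bullet> (\<Sum>i<k. (D ^^ Suc (Suc i)) x' + (D ^^ Suc (Suc i)) y') = 0"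
      unfolding inner_sum_right inner_add_right by (simp add: z del: funpow.simps)
    then have "f \<bullet> D v = 0"
      using z[of 0] by (simp add: Dv inner_add_right inner_diff_right)
    then show "f \<bullet> (A *v v) = 0"
      using f(2) by (simp add: L_eq inner_add_right)
  qed
  then have Hface: "cone_face K (gen_face v)"
    by (simp add: invariant_face_def)
  have "v \<in> F"
    using vK F0[OF _ _ x'F] F0[OF _ _ y'F] F0[OF _ _ n0F] unfolding F_eq
    by (auto simp: gen_face_def fv)
  then have HF: "gen_face v \<subseteq> F"
    by (rule gen_face_subset[OF Fface])
  \<comment> \<open>The minimizing functional vanishes at \<open>v\<close> but not at
    \<open>x'\<close>, so the face of \<open>v\<close> is proper in \<open>F\<close>.\<close>
  have "f0 \<in> Fs" "f0 \<bullet> v = 0"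
    using f0(1) eps(2) by (auto simp: S_def fv)
  then have "x' \<notin> gen_face v"
    using f0x' by (auto simp: gen_face_def)
  then have HF': "gen_face v \<subset> F"
    using HF x'F by blast
  let ?J = "face_join K G (gen_face v)"
  note J = face_join_smallest[OF convex_cone_K Gface Hface]
  have Jcc: "convex_cone ?J"
    using J(1) by (simp add: cone_face_def)
  have "v \<in> ?J" "y' \<in> ?J"
    using J(2) gen_face_refl[OF vK] y'G by auto
  then have "v + \<epsilon> *\<^sub>R y' \<in> ?J"
    using eps(1) by (intro convex_cone_add[OF Jcc] convex_cone_scaleR[OF Jcc]) auto
  \<comment> \<open>In the sum the multiple of \<open>y'\<close> cancels; since \<open>x'\<close>
    lies below the result, it belongs to the join as well.\<close>
  then have "x' + C *\<^sub>R n0 \<in> ?J"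
    by (simp add: v_def)
  moreover have "C *\<^sub>R n0 \<in> K"
    using C(1) by (intro convex_cone_scaleR[OF convex_cone_K] n0K) simp
  ultimately have "x' \<in> ?J"
    using J(1) x'K unfolding cone_face_def by blast
  then have "F \<subseteq> ?J"
    using gen_face_subset[OF J(1)] F_eq by blast
  moreover have "?J \<subseteq> F"
    using J(3)[OF Fface] G(2) HF by blast
  ultimately have "F = ?J"
    by blast
  then show False
    using F G Hinv HF' unfolding invariant_join_irreducible_def by blast
qed

text \<open>If \<open>F\<close> were a join, \<open>q\<close> would lie below some
  \<open>g + h\<close> from proper invariant faces. By minimality \<open>D ^^ p\<close> annihilates
  the generalized components of \<open>g\<close> and \<open>h\<close>, and comparison of orders
  would then give \<open>(D ^^ p) q = 0\<close>.\<close>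

lemma minimal_join_irreducible:
  assumes F: "invariant_face A K F" and x: "x \<in> F" "(D ^^ k) x = 0" "(D ^^ p) x \<noteq> 0"
    and minimal: "\<And>G y. invariant_face A K G \<Longrightarrow> G \<subset> F \<Longrightarrow> y \<in> G \<Longrightarrow> (D ^^ k) y = 0 \<Longrightarrow> (D ^^ p) y = 0"
  obtains q where "F = gen_face q" "\<And>i. (D ^^ i) q \<in> F" "(D ^^ k) q = 0" "(D ^^ p) q \<noteq> 0"
    "invariant_join_irreducible A K F"
proof -
  have face: "cone_face K F" and FK: "F \<subseteq> K"
    using F by (auto simp: invariant_face_def cone_face_def)
  obtain q where q: "\<And>i. (D ^^ i) q \<in> F"
    "\<And>f i. f \<in> Fs \<Longrightarrow> f \<bullet> q = 0 \<Longrightarrow> f \<bullet> (D ^^ i) x = 0"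
    "\<And>f i. f \<in> Fs \<Longrightarrow> f \<bullet> q = 0 \<Longrightarrow> f \<bullet> (D ^^ i) q = 0"
    "\<And>i. (D ^^ i) q = 0 \<longleftrightarrow> (D ^^ i) x = 0"
    "invariant_face A K (gen_face q)"
    by (rule generalized_chain_in_invariant_face[OF F x(1,2)]) (rule that)
  have qF: "q \<in> F" and qK: "q \<in> K"
    using q(1)[of 0] FK by auto
  have qk: "(D ^^ k) q = 0" and qp: "(D ^^ p) q \<noteq> 0"
    using q(4) x by auto
  have F_eq: "F = gen_face q"
    using gen_face_subset[OF face qF] minimal[OF q(5) _ gen_face_refl[OF qK] qk] qp by blast
  \<comment> \<open>The component \<open>e\<close> may lie outside \<open>G\<close>, so minimality
    is applied to a vector \<open>r\<close> of \<open>G\<close> annihilated by the same powers of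
    \<open>D\<close>.\<close>
  have part: "(D ^^ p) e = 0 \<and> tame g"
    if G: "invariant_face A K G" "G \<subset> F" "g \<in> G"
      and dec: "g = e + w" "(D ^^ k) e = 0" "w \<in> range (D ^^ k)" for G g e w
  proof -
    have gF: "g \<in> gen_face q" and gK: "g \<in> K"
      using G F_eq FK by auto
    obtain C where C: "0 < C" "C *\<^sub>R q - g \<in> K"
      using gen_face_dominated[OF qK gF] by blast
    have tame: "tame g"
      by (rule tame_dominated[OF tame_generalized[OF qk] qK gK _ C(2)]) (use C(1) in simp)
    obtain r where r: "\<And>i. (D ^^ i) r \<in> G"
      "\<And>f i. f \<in> Fs \<Longrightarrow> f \<bullet> r = 0 \<Longrightarrow> f \<bullet> (D ^^ i) e = 0"
      "\<And>f i. f \<in> Fs \<Longrightarrow> f \<bullet> r = 0 \<Longrightarrow> f \<bullet> (D ^^ i) r = 0"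
      "\<And>i. (D ^^ i) r = 0 \<longleftrightarrow> (D ^^ i) e = 0"
      "invariant_face A K (gen_face r)"
      by (rule chain_in_invariant_face[OF G(1,3) tame dec]) (rule that)
    have "(D ^^ p) r = 0"
      using minimal[OF G(1,2), of r] r(1)[of 0] r(4)[of k] dec(2) by simp
    then show ?thesis
      using r(4)[of p] tame by simp
  qed
  have "invariant_join_irreducible A K F"
    unfolding invariant_join_irreducible_def
  proof (intro conjI F notI)
    assume "\<exists>G H. invariant_face A K G \<and> invariant_face A K H \<and> G \<subset> F \<and> H \<subset> F \<and> F = face_join K G H"
    then obtain G H where G: "invariant_face A K G" "G \<subset> F" and H: "invariant_face A K H" "H \<subset> F"
      and J: "F = face_join K G H"
      by blast
    have faces: "cone_face K G" "cone_face K H"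
      using G H by (auto simp: invariant_face_def)
    obtain g h where gh: "g \<in> G" "h \<in> H" "g + h - q \<in> K"
      using face_join_dominated[OF convex_cone_K faces, of q] qF unfolding J by blast
    obtain g0 g1 where g: "g = g0 + g1" "(D ^^ k) g0 = 0" "g1 \<in> range (D ^^ k)"
      by (rule fitting_decomposition[where f = D and k = k and x = g, OF linear_D]) (erule stable, rule that)
    obtain h0 h1 where h: "h = h0 + h1" "(D ^^ k) h0 = 0" "h1 \<in> range (D ^^ k)"
      by (rule fitting_decomposition[where f = D and k = k and x = h, OF linear_D]) (erule stable, rule that)
    note pg = part[OF G gh(1) g] and ph = part[OF H gh(2) h]
    \<comment> \<open>The components in the range of \<open>D ^^ k\<close> form the term
      \<open>w\<close> of \<open>dominated_order\<close>.\<close>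
    have eq: "g0 + h0 - q + (g1 + h1) = g + h + - q"
      by (simp add: g(1) h(1))
    have "(D ^^ p) q = 0"
    proof (rule dominated_order[OF qK qk])
      show "g0 + h0 - q + (g1 + h1) \<in> K"
        unfolding eq using gh(3) by simp
      show "tame (g0 + h0 - q + (g1 + h1))"
        unfolding eq using pg ph tame_generalized[OF qk] by (intro tame_add tame_uminus) auto
      show "(D ^^ p) (g0 + h0) = 0"
        using pg ph by (simp add: linear_add[OF linear_Dn])
      show "g1 + h1 \<in> range (D ^^ k)"
        using subspace_add[OF linear_subspace_image[OF linear_Dn subspace_UNIV] g(3) h(3)] .
    qed
    then show False
      using qp by blast
  qed
  then show ?thesis
    using that F_eq q(1) qk qp by blast
qed

text \<open>A minimal face exists because a face is determined by the set of functionals not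
  vanishing on it; the choice minimizes the size of this finite set.\<close>

lemma join_irreducible_subface:
  assumes F0: "invariant_face A K F0" and x: "x \<in> F0" "(D ^^ k) x = 0" "(D ^^ p) x \<noteq> 0"
  obtains q where "gen_face q \<subseteq> F0" "\<And>i. (D ^^ i) q \<in> gen_face q" "(D ^^ k) q = 0" "(D ^^ p) q \<noteq> 0"
    "invariant_join_irreducible A K (gen_face q)"
proof -
  let ?P = "\<lambda>F. invariant_face A K F \<and> F \<subseteq> F0 \<and> (\<exists>x\<in>F. (D ^^ k) x = 0 \<and> (D ^^ p) x \<noteq> 0)"
  define active where "active F = {f \<in> Fs. \<exists>v\<in>F. f \<bullet> v \<noteq> 0}" for F
  have "?P F0"
    using F0 x by blast
  then obtain F where F: "?P F" and least: "\<And>G. ?P G \<Longrightarrow> card (active F) \<le> card (active G)"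
    using ex_has_least_nat[of ?P F0 "\<lambda>F. card (active F)"] by blast
  have minimal: "(D ^^ p) y = 0"
    if G: "invariant_face A K G" "G \<subset> F" "y \<in> G" "(D ^^ k) y = 0" for G y
  proof (rule ccontr)
    assume "(D ^^ p) y \<noteq> 0"
    then have "?P G"
      using G F by blast
    then have le: "card (active F) \<le> card (active G)"
      by (rule least)
    have "active G \<subseteq> active F" "finite (active F)"
      using G(2) finite_Fs by (auto simp: active_def)
    then have eq: "active G = active F"
      using le by (intro card_seteq)
    have "cone_face K G"
      using G(1) by (simp add: invariant_face_def)
    then obtain g where g: "g \<in> G" "G = gen_face g"
      using face_generator by blast
    have "F \<subseteq> G"
    proof
      fix w assume w: "w \<in> F"
      have "f \<bullet> w = 0" if f: "f \<in> Fs" "f \<bullet> g = 0" for f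
      proof -
        have "f \<notin> active G"
          using f unfolding active_def g(2) by (auto simp: gen_face_def)
        then show ?thesis
          using f(1) w unfolding eq by (auto simp: active_def)
      qed
      moreover have "w \<in> K"
        using w F by (auto simp: invariant_face_def cone_face_def)
      ultimately show "w \<in> G"
        unfolding g(2) by (simp add: gen_face_def)
    qed
    then show False
      using G(2) by blast
  qed
  obtain y where y: "y \<in> F" "(D ^^ k) y = 0" "(D ^^ p) y \<noteq> 0"
    using F by blast
  have inv: "invariant_face A K F"
    using F by blast
  obtain q where q: "F = gen_face q" "\<And>i. (D ^^ i) q \<in> F" "(D ^^ k) q = 0" "(D ^^ p) q \<noteq> 0"
    "invariant_join_irreducible A K F"
    by (rule minimal_join_irreducible[OF inv y]) (erule (3) minimal, rule that)
  have "F \<subseteq> F0"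
    using F by blast
  then show ?thesis
    using that[of q] q unfolding q(1)[symmetric] by simp
qed

section \<open>Chains of semi-distinguished faces\<close>

lemma semi_distinguished_gen_face:
  assumes "invariant_join_irreducible A K (gen_face q)" "q \<in> K" "(D ^^ k) q = 0" "q \<noteq> 0"
  shows "semi_distinguished_face A K lam (gen_face q)"
  unfolding semi_distinguished_face_def
  using assms rel_interior_gen_face by (auto simp: generalized_eigenvector_iff)

text \<open>Induction on \<open>p\<close>: put the face of \<open>q\<close> on top and recurse into
  the invariant face generated by all proper iterates of \<open>q\<close>. It contains
  \<open>D q\<close>, for which the exponent has dropped by one.\<close>

lemma semi_distinguished_chain:
  assumes "invariant_face A K F0" "x \<in> F0" "(D ^^ k) x = 0" "(D ^^ p) x \<noteq> 0"
  shows "\<exists>\<C>. (\<forall>F\<in>\<C>. semi_distinguished_face A K lam F \<and> F \<subseteq> F0) \<and> chain\<^sub>\<subseteq> \<C> \<and>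
           finite \<C> \<and> card \<C> = Suc p"
  using assms
proof (induction p arbitrary: F0 x)
  case (0 F0 x)
  obtain q where q: "gen_face q \<subseteq> F0" "\<And>i. (D ^^ i) q \<in> gen_face q" "(D ^^ k) q = 0" "(D ^^ 0) q \<noteq> 0"
    "invariant_join_irreducible A K (gen_face q)"
    by (rule join_irreducible_subface[OF 0]) (rule that)
  have "q \<in> K"
    using q(2)[of 0] by (simp add: gen_face_def)
  then have "semi_distinguished_face A K lam (gen_face q)"
    using q by (intro semi_distinguished_gen_face) auto
  then show ?case
    using q(1) by (intro exI[of _ "{gen_face q}"]) (auto simp: chain_subset_def)
next
  case (Suc p F0 x)
  obtain q where q: "gen_face q \<subseteq> F0" "\<And>i. (D ^^ i) q \<in> gen_face q" "(D ^^ k) q = 0" "(D ^^ Suc p) q \<noteq> 0"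
    "invariant_join_irreducible A K (gen_face q)"
    by (rule join_irreducible_subface[OF Suc.prems]) (rule that)
  have DqK: "(D ^^ i) q \<in> K" for i
    using q(2)[of i] by (simp add: gen_face_def)
  then have qK: "q \<in> K"
    using DqK[of 0] by simp
  have "q \<noteq> 0"
    using q(4) linear_0[OF linear_Dn] by metis
  then have semi: "semi_distinguished_face A K lam (gen_face q)"
    using q qK by (intro semi_distinguished_gen_face) auto
  define r where "r = D q"
  have Dr: "(D ^^ i) r = (D ^^ Suc i) q" for i
    by (simp add: r_def funpow_swap1)
  define n0 where "n0 = (\<Sum>i<k. (D ^^ i) r)"
  have n0K: "n0 \<in> K"
    unfolding n0_def Dr mem_K inner_sum_right using DqK mem_K by (blast intro: sum_nonneg)
  have Dr0: "(D ^^ i) r = 0" if "k \<le> i" for i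
    unfolding Dr by (rule Dn_zero_mono[OF q(3)]) (use that in simp)
  have n0_zero: "f \<bullet> (D ^^ i) r = 0" if f: "f \<in> Fs" "f \<bullet> n0 = 0" for f i
  proof (cases "i < k")
    case True
    have "\<forall>i\<in>{..<k}. 0 \<le> f \<bullet> (D ^^ i) r"
      unfolding Dr using DqK f(1) mem_K by blast
    moreover have "(\<Sum>i<k. f \<bullet> (D ^^ i) r) = 0"
      using f(2) by (simp only: n0_def inner_sum_right)
    ultimately show ?thesis
      using True sum_nonneg_eq_0_iff[of "{..<k}" "\<lambda>i. f \<bullet> (D ^^ i) r"] by simp
  next
    case False
    then show ?thesis
      using Dr0 by simp
  qed
  have inv: "invariant_face A K (gen_face n0)"
  proof (rule invariant_gen_face[OF n0K])
    fix f assume f: "f \<in> Fs" "f \<bullet> n0 = 0"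
    have "D n0 = (\<Sum>i<k. (D ^^ Suc i) r)"
      by (simp add: n0_def linear_sum[OF linear_D])
    then have "f \<bullet> D n0 = 0"
      using n0_zero[OF f] by (simp only: inner_sum_right) simp
    then show "f \<bullet> (A *v n0) = 0"
      using f by (simp add: L_eq inner_add_right)
  qed
  have "r \<in> gen_face n0"
    using n0_zero[of _ 0] DqK[of 1] by (simp add: gen_face_def r_def)
  moreover have "(D ^^ k) r = 0" "(D ^^ p) r \<noteq> 0"
    using Dr0[of k] q(4) Dr by auto
  ultimately obtain \<C> where \<C>: "\<forall>F\<in>\<C>. semi_distinguished_face A K lam F \<and> F \<subseteq> gen_face n0"
    "chain\<^sub>\<subseteq> \<C>" "finite \<C>" "card \<C> = Suc p"
    using Suc.IH[OF inv] by blast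
  have sub: "gen_face n0 \<subseteq> gen_face q"
  proof (rule gen_face_subset[OF cone_face_gen_face])
    have "f \<bullet> n0 = 0" if "f \<in> Fs" "f \<bullet> q = 0" for f
      unfolding n0_def Dr inner_sum_right using q(2) that by (intro sum.neutral) (simp add: gen_face_def del: funpow.simps)
    then show "n0 \<in> gen_face q"
      using n0K by (simp add: gen_face_def)
  qed
  have "q \<notin> gen_face n0"
  proof
    assume mem: "q \<in> gen_face n0"
    \<comment> \<open>Descent from \<open>k\<close>: if \<open>D ^^ Suc i\<close> annihilates
      \<open>q\<close>, then \<open>D ^^ i\<close> annihilates \<open>n0\<close>, and hence also
      \<open>q\<close> if \<open>q\<close> lies in the face of \<open>n0\<close>. This would reach
      the exponent \<open>Suc p\<close>.\<close>
    have "(D ^^ i) q = 0 \<or> k \<le> i" for i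
    proof (induction "k - i" arbitrary: i)
      case 0
      then show ?case by simp
    next
      case (Suc m)
      then have "m = k - Suc i"
        by simp
      then have D0: "(D ^^ Suc i) q = 0"
        using Suc(1)[of "Suc i"] Dn_zero_mono[OF q(3), of "Suc i"] by blast
      have "(D ^^ i) n0 = 0"
      proof -
        have "(D ^^ i) ((D ^^ j) r) = 0" for j
        proof -
          have "(D ^^ i) ((D ^^ j) r) = (D ^^ (i + Suc j)) q"
            by (simp only: Dr funpow_add o_apply)
          then show ?thesis
            using Dn_zero_mono[OF D0, of "i + Suc j"] by simp
        qed
        then show ?thesis
          by (simp add: n0_def linear_sum[OF linear_Dn])
      qed
      then show ?case
        using gen_face_order[OF n0K _ mem q(3)] by blast
    qed
    from this[of "Suc p"] show False
      using q(4) Dn_zero_mono[OF q(3), of "Suc p"] by blast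
  qed
  then have "gen_face q \<notin> \<C>"
    using \<C>(1) gen_face_refl[OF qK] by blast
  then have "card (insert (gen_face q) \<C>) = Suc (Suc p)"
    using \<C> by simp
  moreover have "chain\<^sub>\<subseteq> (insert (gen_face q) \<C>)"
    using \<C>(1,2) sub unfolding chain_subset_def by blast
  ultimately show ?case
    using \<C> semi sub q(1) by (intro exI[of _ "insert (gen_face q) \<C>"]) auto
qed

lemma finite_orders:
  "finite (eigenvector_order A lam ` {x \<in> K. generalized_eigenvector A lam x})"
proof (rule finite_subset)
  show "eigenvector_order A lam ` {x \<in> K. generalized_eigenvector A lam x} \<subseteq> {..k}"
  proof (rule image_subsetI)
    fix x assume "x \<in> {x \<in> K. generalized_eigenvector A lam x}"
    then have "generalized_eigenvector A lam x"
      by simp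
    then obtain p where "eigenvector_order A lam x = Suc p" "(D ^^ Suc p) x = 0" "(D ^^ p) x \<noteq> 0" "p < k"
      by (rule eigenvector_order_Suc) (rule that)
    then show "eigenvector_order A lam x \<in> {..k}"
      by simp
  qed
qed simp

text \<open>The order of a generalized eigenvector chosen in the relative interior strictly
  increases along inclusions, so it maps the chain injectively into
  \<open>{1..max_distinguished_order A K lam}\<close>; finiteness follows as well.\<close>

lemma semi_distinguished_chain_bound:
  assumes semi: "\<And>F. F \<in> \<C> \<Longrightarrow> semi_distinguished_face A K lam F" and chain: "chain\<^sub>\<subseteq> \<C>"
  shows "finite \<C> \<and> card \<C> \<le> max_distinguished_order A K lam"
proof -
  have "\<forall>F\<in>\<C>. \<exists>x. x \<in> rel_interior F \<and> generalized_eigenvector A lam x"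
    using semi unfolding semi_distinguished_face_def by blast
  then obtain x where x: "\<And>F. F \<in> \<C> \<Longrightarrow> x F \<in> rel_interior F"
    "\<And>F. F \<in> \<C> \<Longrightarrow> generalized_eigenvector A lam (x F)"
    by metis
  define ord where "ord F = eigenvector_order A lam (x F)" for F
  have inv: "invariant_face A K F" "invariant_join_irreducible A K F" if "F \<in> \<C>" for F
    using semi[OF that] by (auto simp: semi_distinguished_face_def invariant_join_irreducible_def)
  have xF: "x F \<in> F" if "F \<in> \<C>" for F
    using x(1)[OF that] rel_interior_subset by blast
  have less: "ord G < ord F" if FG: "F \<in> \<C>" "G \<in> \<C>" "G \<subset> F" for F G
  proof -
    obtain p where p: "ord F = Suc p" "(D ^^ Suc p) (x F) = 0" "(D ^^ p) (x F) \<noteq> 0" "p < k"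
      by (rule eigenvector_order_Suc[OF x(2)[OF FG(1)], folded ord_def]) (rule that)
    obtain r where r: "ord G = Suc r" "(D ^^ Suc r) (x G) = 0" "(D ^^ r) (x G) \<noteq> 0" "r < k"
      by (rule eigenvector_order_Suc[OF x(2)[OF FG(2)], folded ord_def]) (rule that)
    have "(D ^^ k) (x G) = 0"
      using x(2)[OF FG(2)] by (simp add: generalized_eigenvector_iff)
    then have "(D ^^ p) (x G) = 0"
      by (rule join_irreducible_order[OF inv(2)[OF FG(1)] x(1)[OF FG(1)] p(2) inv(1)[OF FG(2)] FG(3) xF[OF FG(2)]])
    then have "r < p"
      using r(3) Dn_zero_mono[of p "x G" r] by (cases "r < p") auto
    then show ?thesis
      using p r by simp
  qed
  have inj: "inj_on ord \<C>"
  proof (rule inj_onI, rule ccontr)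
    fix F G assume FG: "F \<in> \<C>" "G \<in> \<C>" "ord F = ord G" "F \<noteq> G"
    then have "F \<subset> G \<or> G \<subset> F"
      using chain unfolding chain_subset_def by blast
    then show False
      using less FG by fastforce
  qed
  have sub: "ord ` \<C> \<subseteq> {1..max_distinguished_order A K lam}"
  proof (rule image_subsetI)
    fix F assume F: "F \<in> \<C>"
    obtain p where "ord F = Suc p" "(D ^^ Suc p) (x F) = 0" "(D ^^ p) (x F) \<noteq> 0" "p < k"
      by (rule eigenvector_order_Suc[OF x(2)[OF F], folded ord_def]) (rule that)
    moreover have "x F \<in> K"
      using xF[OF F] inv(1)[OF F] by (auto simp: invariant_face_def cone_face_def)
    then have "ord F \<le> max_distinguished_order A K lam"
      unfolding max_distinguished_order_def ord_def using x(2)[OF F] by (intro Max_ge finite_orders) auto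
    ultimately show "ord F \<in> {1..max_distinguished_order A K lam}"
      by simp
  qed
  have "finite \<C>"
    using inj_on_finite[OF inj sub] by simp
  moreover have "card \<C> \<le> card {1..max_distinguished_order A K lam}"
    by (rule card_inj_on_le[OF inj sub]) simp
  ultimately show ?thesis
    by simp
qed

end

theorem theorem5p1:
  fixes K :: "(real ^ 'n) set" and A :: "real ^ 'n ^ 'n" and lam :: real
  assumes "polyhedral_cone K"
    and "A \<in> cone_preserving K"
    and "distinguished_eigenvalue A K lam"
  shows "(\<exists>\<C>. (\<forall>F\<in>\<C>. semi_distinguished_face A K lam F) \<and> chain\<^sub>\<subseteq> \<C> \<and>
               finite \<C> \<and> card \<C> = max_distinguished_order A K lam) \<and>
         (\<forall>\<C>. (\<forall>F\<in>\<C>. semi_distinguished_face A K lam F) \<and> chain\<^sub>\<subseteq> \<C> \<longrightarrow>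
               finite \<C> \<and> card \<C> \<le> max_distinguished_order A K lam)"
proof -
  define D where "D x = A *v x - lam *\<^sub>R x" for x
  have linD: "linear D"
    unfolding D_def by (intro linear_compose_sub matrix_vector_mul_linear linear_scaleR)
  obtain k where k: "\<And>j x. (D ^^ j) x = 0 \<Longrightarrow> (D ^^ k) x = 0"
    using kernel_funpow_stabilizes[OF linD] by blast
  obtain Fs where Fs: "finite Fs" "K = {x. \<forall>f\<in>Fs. 0 \<le> f \<bullet> x}"
    using polyhedral_cone_halfspaces[OF assms(1)] by blast
  have proper: "proper_cone K"
    using assms(1) by (simp add: polyhedral_cone_def)
  obtain a b where ab: "0 < b" "\<And>x. x \<in> K \<Longrightarrow> b * norm x \<le> a \<bullet> x"
    using proper_cone_positive_functional[OF proper] by blast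
  have AK: "A *v x \<in> K" if "x \<in> K" for x
    using assms(2) that by (auto simp: cone_preserving_def)
  obtain x where x: "x \<in> K" "x \<noteq> 0" "A *v x = lam *\<^sub>R x"
    using assms(3) by (auto simp: distinguished_eigenvalue_def eigenvector_def)
  \<comment> \<open>The strictly positive functional is positive at \<open>x\<close> and nonnegative
    at \<open>A x\<close>, which is \<open>lam\<close> times \<open>x\<close>.\<close>
  have lam: "0 \<le> lam"
  proof -
    have pos: "0 < a \<bullet> x"
      using ab x by (smt (verit) mult_pos_pos zero_less_norm_iff)
    have "0 \<le> a \<bullet> (A *v x)"
      using ab(1) ab(2)[OF AK[OF x(1)]] by (smt (verit) mult_nonneg_nonneg norm_ge_zero)
    then show ?thesis
      using pos x(3) by (simp add: zero_le_mult_iff)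
  qed
  interpret polyhedral_cone_map A D lam k K Fs
  proof
    show "A *v x = lam *\<^sub>R x + D x" for x
      by (simp add: D_def)
    show "\<exists>a b. 0 < b \<and> (\<forall>x\<in>K. b * norm x \<le> a \<bullet> x)"
      using ab by blast
  qed (fact linear_add[OF linD] linear_scale[OF linD] lam k Fs AK)+
  let ?O = "eigenvector_order A lam ` {x \<in> K. generalized_eigenvector A lam x}"
  have "(D ^^ Suc 0) x = 0"
    using x(3) by (simp add: D_def)
  then have "generalized_eigenvector A lam x"
    using x(2) stable generalized_eigenvector_iff by blast
  then have "?O \<noteq> {}"
    using x(1) by blast
  then have "max_distinguished_order A K lam \<in> ?O"
    unfolding max_distinguished_order_def by (rule Max_in[OF finite_orders])
  then obtain y where y: "y \<in> K" "generalized_eigenvector A lam y"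
    "max_distinguished_order A K lam = eigenvector_order A lam y"
    by blast
  obtain p where p: "eigenvector_order A lam y = Suc p" "(D ^^ Suc p) y = 0" "(D ^^ p) y \<noteq> 0" "p < k"
    by (rule eigenvector_order_Suc[OF y(2)]) (rule that)
  have "(D ^^ k) y = 0"
    using y(2) by (simp add: generalized_eigenvector_iff)
  \<comment> \<open>The whole cone serves as the initial invariant face, with a vector
    \<open>y\<close> attaining the maximal order \<open>Suc p\<close>.\<close>
  from semi_distinguished_chain[OF invariant_face_K y(1) this p(3)]
  have "\<exists>\<C>. (\<forall>F\<in>\<C>. semi_distinguished_face A K lam F) \<and> chain\<^sub>\<subseteq> \<C> \<and>
               finite \<C> \<and> card \<C> = max_distinguished_order A K lam"
    using y(3) p(1) by auto
  then show ?thesis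
    using semi_distinguished_chain_bound by blast
qed

end
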